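(* Let $s,t$ be integers and let $G$ be a planar graph such that, for all integers $i,j$ with $3\le i\le s$ and $3\le j\le t$, $G$ does not contain an $i$-cycle adjacent to a $j$-cycle. Suppose that one of the following holds: (1) $s=3$, $t=3$ and $\Delta(G)\ge 8$; (2) $s=3$, $t=4$ and $\Delta(G)\ge 6$; (3) $s=4$, $t=5$ and $\Delta(G)\ge 5$; (4) $s=4$, $t=7$. Then $G$ is group $(\Delta(G)+1)$-edge-choosable.
   Context: All graphs are finite, simple and undirected; $\Delta(G)$ is the maximum degree of $G$. An $i$-cycle is a cycle of length $i$; two distinct cycles are adjacent if they share at least one edge. Let $H$ be a graph, $A$ an Abelian group, and fix an arbitrary orientation $D$ of $E(H)$. For a function $f:E(H)\to A$, an $(A,f)$-coloring of $H$ is a map $c:V(H)\to A$ such that $c(u)-c(v)\ne f(uv)$ for every edge $uv$ directed from $u$ to $v$. $H$ is group $k$-choosable if for every Abelian group $A$ of order at least $k$, every list assignment $L:V(H)\to 2^A$ with $|L(v)|=k$ for all $v$, and every $f:E(H)\to A$, there is an $(A,f)$-coloring $c$ of $H$ with $c(v)\in L(v)$ for all $v\in V(H)$ (this does not depend on $D$). A graph $G$ is group $k$-edge-choosable if its line graph $\mathcal{L}(G)$ (vertices are the edges of $G$, two adjacent iff the edges share an endpoint) is group $k$-choosable. *)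

theory Defs
  imports "HOL-Analysis.Analysis" "HOL-Algebra.Group"
begin

type_synonym 'v graph = "'v set \<times> 'v set set"

abbreviation verts :: "'v graph \<Rightarrow> 'v set" where "verts G \<equiv> fst G"
abbreviation edges :: "'v graph \<Rightarrow> 'v set set" where "edges G \<equiv> snd G"

definition simple_graph :: "'v graph \<Rightarrow> bool" where
  "simple_graph G \<longleftrightarrow>
     finite (verts G) \<and> (\<forall>e\<in>edges G. e \<subseteq> verts G \<and> card e = 2)"

definition degree :: "'v graph \<Rightarrow> 'v \<Rightarrow> nat" where
  "degree G v = card {e \<in> edges G. v \<in> e}"

text \<open>Inserting 0 only matters for the graph without vertices, whose maximum degree is set to 0.\<close>

definition max_degree :: "'v graph \<Rightarrow> nat" where
  "max_degree G = Max (insert 0 (degree G ` verts G))"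

definition line_graph :: "'v graph \<Rightarrow> 'v set graph" where
  "line_graph G =
     (edges G, {{e, f} | e f. e \<in> edges G \<and> f \<in> edges G \<and> e \<noteq> f \<and> e \<inter> f \<noteq> {}})"

text \<open>A cycle is a subgraph; it has no isolated vertices, so it is represented by its edge set.
  The many vertex sequences that run through the same cycle thus give one and the same object,
  which matters for the requirement that adjacent cycles be distinct.\<close>

definition closed_seq_edges :: "'v list \<Rightarrow> 'v set set" where
  "closed_seq_edges xs = {{xs ! i, xs ! (Suc i mod length xs)} | i. i < length xs}"

definition is_cycle :: "'v graph \<Rightarrow> nat \<Rightarrow> 'v set set \<Rightarrow> bool" where
  "is_cycle G n C \<longleftrightarrow>
     (\<exists>xs. length xs = n \<and> 3 \<le> n \<and> distinct xs \<and> set xs \<subseteq> verts G \<and>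
           C = closed_seq_edges xs \<and> C \<subseteq> edges G)"

definition adjacent_cycles :: "'v set set \<Rightarrow> 'v set set \<Rightarrow> bool" where
  "adjacent_cycles C C' \<longleftrightarrow> C \<noteq> C' \<and> C \<inter> C' \<noteq> {}"

text \<open>The plane is \<^typ>\<open>complex\<close>; edges are arbitrary (not necessarily straight or polygonal) arcs.
  The two conditions on intersections say that edges meet vertices and one another only in common ends.\<close>

definition plane_drawing :: "'v graph \<Rightarrow> ('v \<Rightarrow> complex) \<Rightarrow> ('v set \<Rightarrow> real \<Rightarrow> complex) \<Rightarrow> bool" where
  "plane_drawing G p \<gamma> \<longleftrightarrow>
     inj_on p (verts G) \<and>
     (\<forall>e\<in>edges G. arc (\<gamma> e) \<and> {pathstart (\<gamma> e), pathfinish (\<gamma> e)} = p ` e \<and>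
                  path_image (\<gamma> e) \<inter> p ` verts G = p ` e) \<and>
     (\<forall>e\<in>edges G. \<forall>f\<in>edges G. e \<noteq> f \<longrightarrow>
        path_image (\<gamma> e) \<inter> path_image (\<gamma> f) = p ` (e \<inter> f))"

definition planar :: "'v graph \<Rightarrow> bool" where
  "planar G \<longleftrightarrow> (\<exists>p \<gamma>. plane_drawing G p \<gamma>)"

text \<open>An orientation contains exactly one of \<open>(u, v)\<close> and \<open>(v, u)\<close> for each edge \<open>{u, v}\<close>.\<close>

definition orientation :: "'v graph \<Rightarrow> ('v \<times> 'v) set \<Rightarrow> bool" where
  "orientation H D \<longleftrightarrow> bij_betw (\<lambda>(u, v). {u, v}) D (edges H)"

text \<open>HOL-Algebra writes Abelian groups multiplicatively:
  \<open>c u \<otimes>\<^bsub>A\<^esub> inv\<^bsub>A\<^esub> c v\<close> is \<open>c(u) - c(v)\<close>.\<close>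

definition group_coloring ::
  "'g monoid \<Rightarrow> 'v graph \<Rightarrow> ('v \<times> 'v) set \<Rightarrow> ('v set \<Rightarrow> 'g) \<Rightarrow> ('v \<Rightarrow> 'g) \<Rightarrow> bool" where
  "group_coloring A H D f c \<longleftrightarrow>
     (\<forall>v\<in>verts H. c v \<in> carrier A) \<and>
     (\<forall>(u, v)\<in>D. c u \<otimes>\<^bsub>A\<^esub> inv\<^bsub>A\<^esub> (c v) \<noteq> f {u, v})"

text \<open>A HOL definition cannot quantify over types, so the type \<^typ>\<open>'g\<close> that holds the elements of the
  groups is a parameter. In a theorem it is a free type variable, which makes the
  theorem range over all Abelian groups. The case distinction on the order is needed
  because \<^const>\<open>card\<close> is 0 on infinite sets.\<close>

definition group_choosable :: "'g itself \<Rightarrow> 'v graph \<Rightarrow> nat \<Rightarrow> bool" where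
  "group_choosable (_ :: 'g itself) H k \<longleftrightarrow>
     (\<forall>(A :: 'g monoid) D L f.
        comm_group A \<longrightarrow>
        infinite (carrier A) \<or> k \<le> card (carrier A) \<longrightarrow>
        orientation H D \<longrightarrow>
        (\<forall>v\<in>verts H. L v \<subseteq> carrier A \<and> finite (L v) \<and> card (L v) = k) \<longrightarrow>
        (\<forall>e\<in>edges H. f e \<in> carrier A) \<longrightarrow>
        (\<exists>c. group_coloring A H D f c \<and> (\<forall>v\<in>verts H. c v \<in> L v)))"

definition group_edge_choosable :: "'g itself \<Rightarrow> 'v graph \<Rightarrow> nat \<Rightarrow> bool" where
  "group_edge_choosable T G k \<longleftrightarrow> group_choosable T (line_graph G) k"

end

theory Submission
  imports Defs
begin

text \<open>
  Let \<open>\<Delta>\<close> be the maximum degree of \<open>G\<close>. An edge \<open>uv\<close> of a subgraph \<open>N\<close> meets \<open>d(u) + d(v) - 2\<close>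
  other edges of \<open>N\<close>, and each of them, once coloured, excludes at most one colour for \<open>uv\<close>,
  because translations of a group are injective. If \<open>uv\<close> is light, that is \<open>d(u) + d(v) \<le> \<Delta> + 2\<close>,
  then at most \<open>\<Delta>\<close> of its \<open>\<Delta> + 1\<close> colours are excluded, and \<open>uv\<close> can be coloured after the rest of
  \<open>N\<close>. So the theorem follows by induction if every nonempty subgraph has a light edge. This is
  true (\<open>light_edge_or_cubic\<close>) unless \<open>\<Delta> = 3\<close> and \<open>N\<close> is cubic: the dodecahedron, for example,
  satisfies the fourth condition and has no light edge. A cubic graph contains a cycle with a
  pendant edge, and every colouring of the other edges extends to these edges (\<open>cubic_reducible\<close>).

  For the light edge, planarity is used in one combinatorial form (\<open>ex_cycle_cover\<close>): a nonempty
  plane graph with vertex set \<open>V\<close> and edge set \<open>E\<close> has a set \<open>F\<close> of distinct cycles such that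
  every edge is in at most two of them and \<open>|E| + 1 \<le> |V| + |F|\<close>. In a nonseparable graph with at
  least two edges these are the boundaries of the faces, and the inequality comes from Euler's
  formula; in general they are collected block by block. The faces of such a block are bounded by
  cycles because it arises from a cycle by adding ears, and an ear cuts one face into two whose
  boundaries are again cycles. The topology behind the last step is the theorem on theta curves
  (\<open>theta_split\<close>).

  Given such a cover, let every cycle demand 4, let every edge supply 2 and every vertex of
  degree \<open>d\<close> supply \<open>d - 4\<close>. The supply is \<open>2|E| + (2|E| - 4|V|) = 4(|E| - |V|)\<close>, which is less
  than the demand \<open>4|F|\<close>. If there were no light edge, then the demand could be met locally.
  Indeed all degrees would be at least 3, and vertices of degree 3 would be adjacent only to
  vertices of degree \<open>\<Delta>\<close>. A cycle of length \<open>n\<close> roughly asks each of its edges for \<open>4/n\<close>; two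
  cycles of length above 4 on an edge ask for less than the 2 that the edge has, and because short
  cycles are not adjacent, what remains of it, together with small payments of vertices of large
  degree, makes up for the triangles and for the deficit 1 of the vertices of degree 3.
\<close>

section \<open>Arcs and theta curves in the plane\<close>

text \<open>A larger connected subset of \<open>S\<close> would have to cross the frontier of \<open>X\<close>.\<close>

lemma connected_frontier_imp_component:
  assumes "connected X" "X \<noteq> {}" "X \<subseteq> S" "frontier X \<inter> S = {}"
  shows "X \<in> components S"
  unfolding in_components_maximal
proof (intro conjI allI impI)
  fix D assume D: "D \<noteq> {} \<and> X \<subseteq> D \<and> D \<subseteq> S \<and> connected D"
  have "D \<inter> frontier X = {}"
    using D assms(4) by blast
  moreover have "D \<inter> X \<noteq> {}"
    using D assms(2) by blast
  ultimately have "D - X = {}"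
    using connected_Int_frontier[of D X] D by blast
  then show "D = X"
    using D by blast
qed (use assms in auto)

text \<open>Every member is open and so is the union of the others, hence a connected subset of the
  union stays in one member.\<close>

lemma components_Union_open:
  fixes \<U> :: "'a::topological_space set set"
  assumes "pairwise disjnt \<U>" "\<And>U. U \<in> \<U> \<Longrightarrow> open U \<and> connected U \<and> U \<noteq> {}"
  shows "components (\<Union>\<U>) = \<U>"
proof -
  have sub: "U \<in> components (\<Union>\<U>)" if U: "U \<in> \<U>" for U
    unfolding in_components_maximal
  proof (intro conjI allI impI)
    fix D assume D: "D \<noteq> {} \<and> U \<subseteq> D \<and> D \<subseteq> \<Union>\<U> \<and> connected D"
    have o: "open U" "open (\<Union>(\<U> - {U}))"
      using assms(2) U by auto
    have "U \<inter> \<Union>(\<U> - {U}) = {}"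
      using assms(1) U by (auto simp: pairwise_def disjnt_def)
    then have "U \<inter> D = {} \<or> \<Union>(\<U> - {U}) \<inter> D = {}"
      using D connectedD[OF _ o, of D] by blast
    then show "D = U"
      using D assms(2)[OF U] by blast
  qed (use assms U in auto)
  have "K \<in> \<U>" if K: "K \<in> components (\<Union>\<U>)" for K
  proof -
    obtain x where "x \<in> K"
      using in_components_nonempty[OF K] by blast
    then obtain U where "U \<in> \<U>" "x \<in> U"
      using in_components_subset[OF K] by blast
    then have "K = U"
      using components_eq[OF K sub] \<open>x \<in> K\<close> by blast
    then show ?thesis
      using \<open>U \<in> \<U>\<close> by simp
  qed
  then show ?thesis
    using sub by blast
qed

text \<open>Arcs are represented by their images, because the arguments below form unions and
  intersections of point sets and cut curves into pieces.\<close>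

definition arc_between :: "complex \<Rightarrow> complex \<Rightarrow> complex set \<Rightarrow> bool" where
  "arc_between a b A \<longleftrightarrow> (\<exists>g. arc g \<and> pathstart g = a \<and> pathfinish g = b \<and> path_image g = A)"

lemma arc_between_sym: "arc_between a b A \<Longrightarrow> arc_between b a A"
  unfolding arc_between_def by (metis arc_reversepath path_image_reversepath pathfinish_reversepath pathstart_reversepath)

lemma arc_between_join:
  assumes "arc_between a b A" "arc_between b c B" "A \<inter> B = {b}"
  shows "arc_between a c (A \<union> B)"
proof -
  obtain g h where "arc g" "pathstart g = a" "pathfinish g = b" "path_image g = A"
    "arc h" "pathstart h = b" "pathfinish h = c" "path_image h = B"
    using assms(1,2) unfolding arc_between_def by metis
  then show ?thesis
    unfolding arc_between_def
    by (intro exI[of _ "g +++ h"]) (simp add: arc_join assms(3) path_image_join)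
qed

lemma arc_between_facts:
  assumes "arc_between a b A"
  shows "compact A" "connected A" "a \<in> A" "b \<in> A" "a \<noteq> b"
    "connected (A - {a, b})" "A - {a, b} \<noteq> {}" "a \<in> closure (A - {a, b})" "b \<in> closure (A - {a, b})"
proof -
  obtain g where g: "arc g" "pathstart g = a" "pathfinish g = b" "path_image g = A"
    using assms unfolding arc_between_def by blast
  show "compact A" "connected A" "a \<in> A" "b \<in> A"
    using g compact_arc_image connected_arc_image pathstart_in_path_image pathfinish_in_path_image by blast+
  show ab: "a \<noteq> b"
    using arc_distinct_ends g by metis
  show con: "connected (A - {a, b})"
    using connected_simple_path_endless[OF arc_imp_simple_path[OF g(1)]] g by simp
  show ne: "A - {a, b} \<noteq> {}"
    using nonempty_simple_path_endless[OF arc_imp_simple_path[OF g(1)]] g by simp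
  have inf: "infinite A"
    using \<open>connected A\<close> \<open>a \<in> A\<close> \<open>b \<in> A\<close> ab connected_finite_iff_sing by fastforce
  have lp: "x islimpt A" if "x \<in> A" for x
    using that \<open>connected A\<close> connected_imp_perfect[of A x] ab \<open>a \<in> A\<close> \<open>b \<in> A\<close> by force
  \<comment> \<open>An arc has no isolated points, and removing finitely many points does not change limit points.\<close>
  have "x \<in> closure (A - {a, b})" if "x \<in> A" for x
  proof -
    have "A = (A - {a,b}) \<union> {a,b}" using \<open>a \<in> A\<close> \<open>b \<in> A\<close> by auto
    then have "x islimpt (A - {a,b})"
      using lp[OF that] by (metis islimpt_Un islimpt_finite finite.emptyI finite.insertI)
    then show ?thesis
      by (simp add: closure_def)
  qed
  then show "a \<in> closure (A - {a, b})" "b \<in> closure (A - {a, b})"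
    using \<open>a \<in> A\<close> \<open>b \<in> A\<close> by auto
qed

text \<open>The Jordan curve theorem without the distinction between inside and outside: the face that
  an ear cuts may be bounded or unbounded, and both are to be treated alike.\<close>

lemma two_arcs_components:
  assumes "arc_between a b A" "arc_between a b B" "A \<inter> B = {a, b}"
  obtains X Y where "components (- (A \<union> B)) = {X, Y}" "X \<noteq> Y" "X \<inter> Y = {}" "X \<union> Y = - (A \<union> B)"
    "frontier X = A \<union> B" "frontier Y = A \<union> B" "open X" "open Y" "connected X" "connected Y"
    "X \<noteq> {}" "Y \<noteq> {}"
proof -
  obtain g where g: "arc g" "pathstart g = a" "pathfinish g = b" "path_image g = A"
    using assms(1) unfolding arc_between_def by blast
  obtain h where h: "arc h" "pathstart h = b" "pathfinish h = a" "path_image h = B"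
    using arc_between_sym[OF assms(2)] unfolding arc_between_def by blast
  have s: "simple_path (g +++ h)"
    by (rule simple_path_join_loop) (use g h assms(3) in auto)
  have i: "path_image (g +++ h) = A \<union> B" "pathfinish (g +++ h) = pathstart (g +++ h)"
    using g h by (simp_all add: path_image_join)
  obtain X Y where XY: "X \<noteq> {}" "open X" "connected X" "Y \<noteq> {}" "open Y" "connected Y"
      "X \<inter> Y = {}" "X \<union> Y = - (A \<union> B)" "frontier X = A \<union> B" "frontier Y = A \<union> B"
    using Jordan_curve[OF s i(2)] unfolding i(1) by metis
  have "components (\<Union>{X, Y}) = {X, Y}"
    by (rule components_Union_open) (use XY in \<open>auto simp: pairwise_def disjnt_def\<close>)
  then have c: "components (- (A \<union> B)) = {X, Y}"
    using XY by simp
  have "X \<noteq> Y"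
    using XY by blast
  then show thesis
    using that[OF c] XY by blast
qed

text \<open>Without its ends, the arc \<open>C\<close> is connected, so it lies on one side of the curve \<open>A \<union> B\<close>.
  The other side remains a component when \<open>C\<close> is removed as well.\<close>

lemma two_arcs_component_avoiding:
  assumes "arc_between a b A" "arc_between a b B" "arc_between a b C"
    and "A \<inter> B = {a, b}" "A \<inter> C = {a, b}" "B \<inter> C = {a, b}"
  obtains X Y where "components (- (A \<union> B)) = {X, Y}" "X \<inter> Y = {}" "X \<union> Y = - (A \<union> B)"
    "frontier X = A \<union> B" "open X" "connected X" "X \<noteq> {}" "C - {a, b} \<subseteq> Y"
    "X \<in> components (- (A \<union> B \<union> C))"
proof -
  obtain X Y where XY: "components (- (A \<union> B)) = {X, Y}" "X \<noteq> Y" "X \<inter> Y = {}" "X \<union> Y = - (A \<union> B)"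
    "frontier X = A \<union> B" "frontier Y = A \<union> B" "open X" "open Y" "connected X" "connected Y"
    "X \<noteq> {}" "Y \<noteq> {}"
    using two_arcs_components[OF assms(1,2,4)] by metis
  note C = arc_between_facts[OF assms(3)]
  have "C - {a, b} \<subseteq> X \<union> Y"
    using XY(4) assms(5,6) by blast
  then have side: "C - {a, b} \<subseteq> X \<or> C - {a, b} \<subseteq> Y"
    using connectedD[OF C(6) XY(7,8)] XY(3) by blast
  have comp: "Z \<in> components (- (A \<union> B \<union> C))"
    if "Z \<in> {X, Y}" "(C - {a, b}) \<inter> Z = {}" for Z
  proof (rule connected_frontier_imp_component)
    have "a \<in> A" "b \<in> A"
      using arc_between_facts[OF assms(1)] by auto
    then show "Z \<subseteq> - (A \<union> B \<union> C)"
      using that XY(4) by blast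
  qed (use that XY in auto)
  show thesis
  proof (cases "C - {a, b} \<subseteq> Y")
    case True
    then show ?thesis
      using that[of X Y] XY comp[of X] by blast
  next
    case False
    then have "C - {a, b} \<subseteq> X"
      using side by blast
    moreover have "components (- (A \<union> B)) = {Y, X}"
      using XY(1) by blast
    ultimately show ?thesis
      using that[of Y X] XY comp[of Y] by blast
  qed
qed

text \<open>The arc \<open>C\<close> cuts the component \<open>W\<close> of the complement of the closed curve \<open>A \<union> B\<close> into two.
  The two parts are the side \<open>X\<close> of \<open>A \<union> C\<close> that avoids \<open>B\<close> and the side \<open>Z\<close> of \<open>B \<union> C\<close> that
  avoids \<open>A\<close>. They have different frontiers, so they are different components of the complement of
  the theta curve. That nothing else is left is Janiszewski's theorem: two points that neither \<open>A
  \<union> B\<close> nor \<open>A \<union> C\<close> separates are not separated by the union of these curves, as their intersection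
  \<open>A\<close> is connected.\<close>

lemma theta_split:
  assumes A: "arc_between a b A" and B: "arc_between a b B" and C: "arc_between a b C"
    and AB: "A \<inter> B = {a, b}" and AC: "A \<inter> C = {a, b}" and BC: "B \<inter> C = {a, b}"
    and W: "W \<in> components (- (A \<union> B))" and CW: "C - {a, b} \<subseteq> W"
  obtains X Z where "open X" "open Z" "connected X" "connected Z" "X \<noteq> {}" "Z \<noteq> {}" "X \<inter> Z = {}"
    "X \<union> Z = W - C" "frontier X = A \<union> C" "frontier Z = B \<union> C"
proof -
  note fA = arc_between_facts[OF A] and fB = arc_between_facts[OF B] and fC = arc_between_facts[OF C]
  have BA: "B \<inter> A = {a, b}" and CA: "C \<inter> A = {a, b}" and CB: "C \<inter> B = {a, b}"
    using AB AC BC by auto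
  let ?T = "A \<union> B \<union> C"
  obtain U W' where U: "components (- (A \<union> B)) = {U, W'}" "U \<inter> W' = {}" "U \<union> W' = - (A \<union> B)"
    "frontier U = A \<union> B" "open U" "connected U" "U \<noteq> {}" "C - {a, b} \<subseteq> W'"
    "U \<in> components (- (A \<union> B \<union> C))"
    by (rule two_arcs_component_avoiding[OF A B C AB AC BC])
  have "W = W'"
  proof -
    obtain c where "c \<in> C - {a, b}"
      using fC(7) by (meson all_not_in_conv)
    then have "c \<in> W" "c \<in> W'"
      using CW U(8) by auto
    then have "W \<noteq> U"
      using U(2) by auto
    then show ?thesis
      using W U(1) by simp
  qed
  obtain X Y where X: "components (- (A \<union> C)) = {X, Y}" "X \<inter> Y = {}" "X \<union> Y = - (A \<union> C)"
    "frontier X = A \<union> C" "open X" "connected X" "X \<noteq> {}" "B - {a, b} \<subseteq> Y"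
    "X \<in> components (- (A \<union> C \<union> B))"
    by (rule two_arcs_component_avoiding[OF A C B AC AB CB])
  obtain Z V where Z: "components (- (B \<union> C)) = {Z, V}" "Z \<inter> V = {}" "Z \<union> V = - (B \<union> C)"
    "frontier Z = B \<union> C" "open Z" "connected Z" "Z \<noteq> {}" "A - {a, b} \<subseteq> V"
    "Z \<in> components (- (B \<union> C \<union> A))"
    by (rule two_arcs_component_avoiding[OF B C A BC BA CA])
  have T: "A \<union> C \<union> B = ?T" "B \<union> C \<union> A = ?T"
    by auto
  have cU: "U \<in> components (- ?T)" and cX: "X \<in> components (- ?T)" and cZ: "Z \<in> components (- ?T)"
    using U(9) X(9) Z(9) unfolding T by auto
  obtain u v where "u \<in> A" "u \<noteq> a" "u \<noteq> b" "v \<in> B" "v \<noteq> a" "v \<noteq> b"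
    using fA(7) fB(7) by auto
  then have "u \<in> A" "u \<notin> B" "u \<notin> C" "v \<in> B" "v \<notin> A" "v \<notin> C"
    using AB AC BC by auto
  then have "A \<union> B \<noteq> A \<union> C" "A \<union> B \<noteq> B \<union> C" "A \<union> C \<noteq> B \<union> C"
    by auto
  then have "U \<noteq> X" "U \<noteq> Z" "X \<noteq> Z"
    using U(4) X(4) Z(4) by metis+
  then have dis: "U \<inter> X = {}" "U \<inter> Z = {}" "X \<inter> Z = {}"
    using components_eq[OF cU cX] components_eq[OF cU cZ] components_eq[OF cX cZ] by blast+
  have XT: "X \<subseteq> - ?T" and ZT: "Z \<subseteq> - ?T"
    using in_components_subset cX cZ by blast+
  have XW: "X \<subseteq> W - C"
    using XT dis(1) U(3) \<open>W = W'\<close> by blast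
  have ZW: "Z \<subseteq> W - C"
    using ZT dis(2) U(3) \<open>W = W'\<close> by blast
  have ZY: "Z \<subseteq> Y"
    using ZT dis(3) X(3) by blast
  \<comment> \<open>A point of \<open>W\<close> outside \<open>X\<close> is on the same side as \<open>Z\<close> of both \<open>A \<union> B\<close> and \<open>A \<union> C\<close>.\<close>
  have rest: "w \<in> Z" if w: "w \<in> W - C" "w \<notin> X" for w
  proof -
    obtain z where z: "z \<in> Z"
      using Z(7) by blast
    have wW: "w \<in> - (A \<union> B)"
      using in_components_subset[OF W] w by blast
    then have wY: "w \<in> Y"
      using w X(3) by blast
    have 1: "connected_component (- (A \<union> B)) w z"
      using W w ZW z in_components_subset[OF W] in_components_connected[OF W]
      unfolding connected_component_def by blast
    have "Y \<in> components (- (A \<union> C))"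
      using X(1) by blast
    then have 2: "connected_component (- (A \<union> C)) w z"
      using wY ZY z in_components_subset in_components_connected
      unfolding connected_component_def by blast
    have "(A \<union> B) \<inter> (A \<union> C) = A \<union> B \<inter> C"
      by auto
    then have eq: "(A \<union> B) \<inter> (A \<union> C) = A" "(A \<union> B) \<union> (A \<union> C) = ?T"
      unfolding BC using fA(3,4) by auto
    have wz: "connected_component (- ?T) w z"
      using Janiszewski[of "A \<union> B" "A \<union> C" w z] 1 2 fA(1,2) fB(1) fC(1) unfolding eq
      by (simp add: compact_Un compact_imp_closed closed_Un)
    obtain x where x: "Z = connected_component_set (- ?T) x"
      using cZ by (rule componentsE)
    have "connected_component (- ?T) x z"
      using z unfolding x mem_Collect_eq .
    then have "connected_component (- ?T) x w"
      using connected_component_sym[OF wz] by (rule connected_component_trans)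
    then show "w \<in> Z"
      unfolding x mem_Collect_eq .
  qed
  have un: "X \<union> Z = W - C"
    using XW ZW rest by auto
  show thesis
    by (rule that[OF X(5) Z(5) X(6) Z(6) X(7) Z(7) dis(3) un X(4) Z(4)])
qed

section \<open>Paths, cycles and ears\<close>

fun path_edges :: "'v list \<Rightarrow> 'v set set" where
  "path_edges (x # y # xs) = insert {x, y} (path_edges (y # xs))"
| "path_edges xs = {}"

lemma path_edges_append: "path_edges (xs @ a # ys) = path_edges (xs @ [a]) \<union> path_edges (a # ys)"
  by (induction xs rule: path_edges.induct) auto

lemma path_edges_rev: "path_edges (rev xs) = path_edges xs"
proof (induction xs rule: path_edges.induct)
  case (1 x y xs)
  have "path_edges (rev xs @ [y, x]) = path_edges (rev xs @ [y]) \<union> path_edges [y, x]"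
    using path_edges_append[of "rev xs" y "[x]"] by simp
  then show ?case
    using 1 by (simp add: insert_commute)
qed auto

lemma path_edges_rev_between: "path_edges (b # rev ws @ [a]) = path_edges (a # ws @ [b])"
  using path_edges_rev[of "a # ws @ [b]"] by simp

lemma path_edges_subset: "e \<in> path_edges xs \<Longrightarrow> e \<subseteq> set xs"
  by (induction xs rule: path_edges.induct) auto

lemma Union_path_edges: "2 \<le> length xs \<Longrightarrow> \<Union>(path_edges xs) = set xs"
proof (induction xs rule: path_edges.induct)
  case (1 x y xs)
  then show ?case by (cases xs) auto
qed auto

lemma Union_path_edges_between: "\<Union>(path_edges (a # us @ [b])) = insert a (insert b (set us))"
  using Union_path_edges[of "a # us @ [b]"] by auto

lemma finite_path_edges: "finite (path_edges xs)"
  by (induction xs rule: path_edges.induct) auto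

lemma card_path_edge: "distinct xs \<Longrightarrow> e \<in> path_edges xs \<Longrightarrow> card e = 2"
  by (induction xs rule: path_edges.induct) auto

lemma card_path_edges: "distinct xs \<Longrightarrow> card (path_edges xs) = length xs - 1"
proof (induction xs rule: path_edges.induct)
  case (1 x y xs)
  have "{x, y} \<notin> path_edges (y # xs)"
    using path_edges_subset[of "{x, y}" "y # xs"] 1(2) by auto
  then show ?case
    using 1 by (simp add: finite_path_edges)
qed auto

text \<open>A common edge would have both ends in \<open>{a, b}\<close>, so both paths would consist of the edge
  \<open>ab\<close> alone.\<close>

lemma path_edges_between_disjoint:
  assumes "distinct (a # b # us @ ws)" "us @ ws \<noteq> []"
  shows "path_edges (a # us @ [b]) \<inter> path_edges (a # ws @ [b]) = {}"
proof -
  have *: "us = []" if e: "{a, b} \<in> path_edges (a # us @ [b])" and d: "distinct (a # b # us)"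
    for us :: "'a list"
  proof (cases us)
    case (Cons x xs)
    have "{a, b} \<in> path_edges (x # xs @ [b])"
      using e Cons d by (auto simp: doubleton_eq_iff)
    then show ?thesis
      using path_edges_subset[of "{a, b}" "x # xs @ [b]"] d Cons by auto
  qed auto
  have "False" if e: "e \<in> path_edges (a # us @ [b])" "e \<in> path_edges (a # ws @ [b])" for e
  proof -
    have "e \<subseteq> {a, b}"
      using path_edges_subset[OF e(1)] path_edges_subset[OF e(2)] assms(1) by auto
    moreover have "card e = 2"
      using card_path_edge[OF _ e(1)] assms(1) by auto
    ultimately have "e = {a, b}"
      using assms(1) by (intro card_seteq) auto
    then show False
      using *[of us] *[of ws] e assms by auto
  qed
  then show ?thesis
    by blast
qed

text \<open>Cycles of unspecified length and without an ambient graph; \<open>is_cycle_iff\<close> relates them to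
  \<^const>\<open>is_cycle\<close>. Closing a path at its first vertex makes the lemmas on \<^const>\<open>path_edges\<close> available.\<close>

definition graph_cycle :: "'v set set \<Rightarrow> bool" where
  "graph_cycle C \<longleftrightarrow> (\<exists>zs. 3 \<le> length zs \<and> distinct zs \<and> C = path_edges (zs @ [hd zs]))"

lemma graph_cycle_from:
  assumes "graph_cycle C" "a \<in> \<Union>C"
  obtains zs where "distinct (a # zs)" "2 \<le> length zs" "C = path_edges (a # zs @ [a])"
proof -
  obtain xs where xs: "3 \<le> length xs" "distinct xs" "C = path_edges (xs @ [hd xs])"
    using assms(1) unfolding graph_cycle_def by blast
  have "a \<in> set xs"
    using Union_path_edges[of "xs @ [hd xs]"] assms(2) xs by (cases xs) auto
  then obtain us ws where uw: "xs = us @ a # ws"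
    by (meson split_list)
  have "C = path_edges (a # (ws @ us) @ [a])"
  proof (cases us)
    case Nil
    then show ?thesis using xs uw by simp
  next
    case (Cons u us')
    have "path_edges (us @ a # ws @ [u]) = path_edges (us @ [a]) \<union> path_edges (a # ws @ [u])"
      by (rule path_edges_append)
    moreover have "path_edges ((a # ws) @ u # us' @ [a]) = path_edges ((a # ws) @ [u]) \<union> path_edges (u # us' @ [a])"
      by (rule path_edges_append)
    ultimately show ?thesis
      using xs(3) uw Cons by auto
  qed
  then show thesis
    using that[of "ws @ us"] xs uw by auto
qed

text \<open>Together with \<open>graph_cycle_paths\<close>, this exchanges a cycle for two internally disjoint paths
  between two given vertices. It is used with the ends of an ear, where the paths become the arcs
  that \<open>theta_split\<close> is about.\<close>

lemma graph_cycle_split: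
  assumes "graph_cycle C" "a \<in> \<Union>C" "b \<in> \<Union>C" "a \<noteq> b"
  obtains us ws where "distinct (a # b # us @ ws)" "us @ ws \<noteq> []"
    "C = path_edges (a # us @ [b]) \<union> path_edges (a # ws @ [b])"
proof -
  obtain zs where zs: "distinct (a # zs)" "2 \<le> length zs" "C = path_edges (a # zs @ [a])"
    using graph_cycle_from[OF assms(1,2)] .
  have "b \<in> set zs"
    using assms(3,4) Union_path_edges_between[of a zs a] zs(3) by auto
  then obtain us rs where ur: "zs = us @ b # rs"
    by (meson split_list)
  have "C = path_edges (a # us @ [b]) \<union> path_edges (b # rs @ [a])"
    using path_edges_append[of "a # us" b "rs @ [a]"] zs(3) ur by simp
  then have "C = path_edges (a # us @ [b]) \<union> path_edges (a # rev rs @ [b])"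
    using path_edges_rev_between[of b "rev rs" a] by simp
  then show thesis
    using that[of us "rev rs"] zs(1,2) ur by (cases us; cases rs) auto
qed

lemma graph_cycle_paths:
  assumes "distinct (a # b # us @ ws)" "us @ ws \<noteq> []"
  shows "graph_cycle (path_edges (a # us @ [b]) \<union> path_edges (a # ws @ [b]))"
proof -
  let ?zs = "a # us @ b # rev ws"
  have "path_edges (?zs @ [hd ?zs]) = path_edges (a # us @ [b]) \<union> path_edges (b # rev ws @ [a])"
    using path_edges_append[of "a # us" b "rev ws @ [a]"] by simp
  then have "path_edges (a # us @ [b]) \<union> path_edges (a # ws @ [b]) = path_edges (?zs @ [hd ?zs])"
    unfolding path_edges_rev_between by simp
  moreover have "3 \<le> length ?zs" "distinct ?zs"
    using assms by (auto simp: neq_Nil_conv)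
  ultimately show ?thesis
    unfolding graph_cycle_def by blast
qed

text \<open>The two edges at a given vertex, separated from the path that avoids this vertex: what
  degrees and triangles are computed from.\<close>

lemma graph_cycle_at:
  assumes "graph_cycle C" "v \<in> \<Union>C"
  obtains x y ms where "distinct (v # x # ms @ [y])"
    "C = insert {v, x} (insert {v, y} (path_edges (x # ms @ [y])))"
proof -
  obtain zs where zs: "distinct (v # zs)" "2 \<le> length zs" "C = path_edges (v # zs @ [v])"
    using graph_cycle_from[OF assms] .
  obtain x zs' where x: "zs = x # zs'" "zs' \<noteq> []"
    using zs(2) by (cases zs rule: path_edges.cases) auto
  obtain ms y where y: "zs' = ms @ [y]"
    using x(2) by (metis rev_exhaust)
  have "path_edges ((x # ms) @ y # [v]) = path_edges (x # ms @ [y]) \<union> path_edges [y, v]"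
    using path_edges_append[of "x # ms" y "[v]"] by simp
  then have "C = insert {v, x} (insert {v, y} (path_edges (x # ms @ [y])))"
    using zs(3) x y by (simp add: insert_commute)
  then show thesis
    using that[of x ms y] zs(1) x y by simp
qed

lemma graph_cycle_nonempty: "graph_cycle C \<Longrightarrow> C \<noteq> {}"
  unfolding graph_cycle_def by (auto simp: neq_Nil_conv Suc_le_length_iff numeral_3_eq_3)

lemma graph_cycle_degree:
  assumes "graph_cycle C" "v \<in> \<Union>C"
  shows "card {e \<in> C. v \<in> e} = 2"
proof -
  obtain x y ms where *: "distinct (v # x # ms @ [y])"
    "C = insert {v, x} (insert {v, y} (path_edges (x # ms @ [y])))"
    using graph_cycle_at[OF assms] .
  have "v \<notin> e" if "e \<in> path_edges (x # ms @ [y])" for e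
    using path_edges_subset[OF that] * by auto
  then have "{e \<in> C. v \<in> e} = {{v, x}, {v, y}}"
    using *(2) by auto
  then show ?thesis
    using *(1) by (simp add: doubleton_eq_iff)
qed

lemma closed_seq_edges_eq:
  assumes "xs \<noteq> []"
  shows "closed_seq_edges xs = path_edges (xs @ [hd xs])"
proof -
  have pe: "path_edges ys = {{ys ! i, ys ! Suc i} | i. Suc i < length ys}" for ys :: "'a list"
  proof (induction ys rule: path_edges.induct)
    case (1 x y ys)
    have "{{(x # y # ys) ! i, (x # y # ys) ! Suc i} |i. Suc i < length (x # y # ys)} =
      insert {x, y} {{(y # ys) ! i, (y # ys) ! Suc i} |i. Suc i < length (y # ys)}" (is "?L = ?R")
    proof
      show "?L \<subseteq> ?R"
      proof
        fix e assume "e \<in> ?L"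
        then obtain i where "e = {(x # y # ys) ! i, (x # y # ys) ! Suc i}" "Suc i < length (x # y # ys)"
          by blast
        then show "e \<in> ?R"
          by (cases i) auto
      qed
      show "?R \<subseteq> ?L"
      proof
        fix e assume "e \<in> ?R"
        then consider "e = {x, y}" | i where "e = {(y # ys) ! i, (y # ys) ! Suc i}" "Suc i < length (y # ys)"
          by blast
        then show "e \<in> ?L"
        proof cases
          case 1
          then show ?thesis by (auto intro!: exI[of _ 0])
        next
          case 2
          then show ?thesis by (auto intro!: exI[of _ "Suc i"])
        qed
      qed
    qed
    then show ?case using 1 by simp
  qed auto
  have "{(xs @ [hd xs]) ! i, (xs @ [hd xs]) ! Suc i} = {xs ! i, xs ! (Suc i mod length xs)}" if "i < length xs" for i
  proof (cases "Suc i = length xs")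
    case True
    then show ?thesis using assms by (simp add: nth_append hd_conv_nth)
  next
    case False
    then show ?thesis using that by (simp add: nth_append)
  qed
  then show ?thesis
    unfolding closed_seq_edges_def pe by (auto; metis)
qed

lemma card_closed_seq_edges:
  assumes "3 \<le> length xs" "distinct xs"
  shows "card (path_edges (xs @ [hd xs])) = length xs"
proof -
  obtain x zs where x: "xs = x # zs" "2 \<le> length zs"
    using assms by (cases xs) auto
  obtain y zs' where y: "zs = y # zs'" "zs' \<noteq> []"
    using x(2) by (cases zs rule: path_edges.cases) auto
  obtain ms z where z: "zs' = ms @ [z]"
    using y(2) by (metis rev_exhaust)
  have "path_edges ((y # ms) @ z # [x]) = path_edges (y # ms @ [z]) \<union> path_edges [z, x]"
    using path_edges_append[of "y # ms" z "[x]"] by simp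
  then have eq: "path_edges (xs @ [hd xs]) = insert {x, y} (insert {x, z} (path_edges (y # ms @ [z])))"
    using x y z by (simp add: insert_commute)
  have no: "x \<notin> e" if "e \<in> path_edges (y # ms @ [z])" for e
    using path_edges_subset[OF that] assms x y z by auto
  then have "{x, z} \<notin> path_edges (y # ms @ [z])" "{x, y} \<notin> insert {x, z} (path_edges (y # ms @ [z]))"
    using assms x y z by (auto simp: doubleton_eq_iff)
  then show ?thesis
    unfolding eq using card_path_edges[of "y # ms @ [z]"] assms x y z by (simp add: finite_path_edges)
qed

lemma is_cycle_iff:
  assumes "\<Union>(edges G) \<subseteq> verts G"
  shows "is_cycle G n C \<longleftrightarrow> graph_cycle C \<and> C \<subseteq> edges G \<and> card C = n"
proof
  assume "is_cycle G n C"
  then obtain xs where xs: "length xs = n" "3 \<le> n" "distinct xs" "C = closed_seq_edges xs" "C \<subseteq> edges G"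
    unfolding is_cycle_def by blast
  then have "C = path_edges (xs @ [hd xs])"
    using closed_seq_edges_eq[of xs] by fastforce
  then show "graph_cycle C \<and> C \<subseteq> edges G \<and> card C = n"
    using xs card_closed_seq_edges[of xs] unfolding graph_cycle_def by blast
next
  assume C: "graph_cycle C \<and> C \<subseteq> edges G \<and> card C = n"
  then obtain xs where xs: "3 \<le> length xs" "distinct xs" "C = path_edges (xs @ [hd xs])"
    unfolding graph_cycle_def by blast
  moreover have "set xs \<subseteq> verts G"
    using Union_path_edges[of "xs @ [hd xs]"] xs C assms by fastforce
  moreover have "C = closed_seq_edges xs"
    using closed_seq_edges_eq[of xs] xs by fastforce
  ultimately show "is_cycle G n C"
    unfolding is_cycle_def using C card_closed_seq_edges[of xs] by metis
qed

abbreviation reachable :: "'v set set \<Rightarrow> 'v \<Rightarrow> 'v \<Rightarrow> bool" where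
  "reachable B x y \<equiv> (x, y) \<in> {(u, v). {u, v} \<in> B}\<^sup>*"

lemma reachable_sym: "reachable B x y \<Longrightarrow> reachable B y x"
proof -
  have "sym {(u, v). {u, v} \<in> B}"
    by (auto simp: sym_def insert_commute)
  then show "reachable B x y \<Longrightarrow> reachable B y x"
    by (meson sym_rtrancl symD)
qed

text \<open>Follow a walk from \<open>a\<close>. As long as it stays outside \<open>X\<close>, or returns to \<open>X\<close> only in \<open>a\<close>, the
  vertex reached is joined to \<open>a\<close> by a path with inner vertices outside \<open>X\<close> (cut the walk short
  when it repeats a vertex). The first time that the walk reaches another vertex of \<open>X\<close>, this path
  is an ear.\<close>

lemma reachable_between_imp_ear:
  assumes "reachable B a b" "a \<in> X" "b \<in> X" "a \<noteq> b" "\<forall>e\<in>B. card e = 2"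
  obtains c d us where "c \<in> X" "d \<in> X" "distinct (c # d # us)" "set us \<inter> X = {}"
    "path_edges (c # us @ [d]) \<subseteq> B"
proof -
  define ear where "ear \<longleftrightarrow> (\<exists>c d us. c \<in> X \<and> d \<in> X \<and> distinct (c # d # us) \<and> set us \<inter> X = {} \<and>
    path_edges (c # us @ [d]) \<subseteq> B)"
  have "ear \<or> y = a \<or> (y \<notin> X \<and> (\<exists>us. distinct (a # us @ [y]) \<and> path_edges (a # us @ [y]) \<subseteq> B \<and> set us \<inter> X = {}))"
    if "reachable B a y" for y
    using that
  proof (induction rule: rtrancl_induct)
    case (step y z)
    have yz: "{y, z} \<in> B" "y \<noteq> z"
      using step(2) assms(5) by (auto dest!: bspec)
    consider "ear" | "y = a" | us where "y \<notin> X" "distinct (a # us @ [y])" "path_edges (a # us @ [y]) \<subseteq> B" "set us \<inter> X = {}"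
      using step(3) by blast
    then show ?case
    proof cases
      case 1
      then show ?thesis by simp
    next
      case 2
      show ?thesis
      proof (cases "z \<in> X")
        case True
        then have "ear"
          unfolding ear_def using 2 yz assms(2)
          by (intro exI[of _ a] exI[of _ z] exI[of _ "[]"]) auto
        then show ?thesis by simp
      next
        case False
        then show ?thesis
          using 2 yz by (intro disjI2 conjI exI[of _ "[]"]) auto
      qed
    next
      case (3 us)
      have pe: "path_edges ((a # us) @ y # [z]) \<subseteq> B"
        using path_edges_append[of "a # us" y "[z]"] 3(3) yz by simp
      show ?thesis
      proof (cases "z \<in> X")
        case True
        then have "ear" if "z \<noteq> a"
          unfolding ear_def using 3 assms(2) pe that
          by (intro exI[of _ a] exI[of _ z] exI[of _ "us @ [y]"]) auto
        then show ?thesis by auto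
      next
        case z: False
        show ?thesis
        proof (cases "z \<in> set us")
          case True
          then obtain ps qs where us: "us = ps @ z # qs"
            by (meson split_list)
          then have "path_edges (a # ps @ [z]) \<subseteq> B"
            using 3(3) path_edges_append[of "a # ps" z "qs @ [y]"] by auto
          then show ?thesis
            using z us 3 by (intro disjI2 conjI exI[of _ ps]) auto
        next
          case False
          then show ?thesis
            using z yz 3 pe assms(2) by (intro disjI2 conjI exI[of _ "us @ [y]"]) auto
        qed
      qed
    qed
  qed simp
  from this[OF assms(1)] have ear
    using assms(3,4) by auto
  then show thesis
    using that unfolding ear_def by blast
qed

text \<open>The vertex set of a set of edges is its union. Two parts with at most one common vertex
  mean that the graph is disconnected or has a cut vertex.\<close>

definition nonseparable :: "'v set set \<Rightarrow> bool" where
  "nonseparable E \<longleftrightarrow> (\<forall>A B. A \<union> B = E \<longrightarrow> A \<inter> B = {} \<longrightarrow> A \<noteq> {} \<longrightarrow> B \<noteq> {} \<longrightarrow>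
     (\<exists>a b. a \<noteq> b \<and> {a, b} \<subseteq> \<Union>A \<inter> \<Union>B))"

text \<open>Let \<open>A\<close> be the component of some edge in the graph \<open>E - M\<close>. It meets the other edges only
  in vertices of \<open>M\<close>, and in at least two of them because \<open>E\<close> is nonseparable. These two vertices
  are connected in \<open>E - M\<close>.\<close>

lemma nonseparable_ear:
  assumes "nonseparable E" "\<forall>e\<in>E. card e = 2" "M \<subset> E" "M \<noteq> {}"
  obtains c d us where "c \<in> \<Union>M" "d \<in> \<Union>M" "distinct (c # d # us)" "set us \<inter> \<Union>M = {}"
    "path_edges (c # us @ [d]) \<subseteq> E - M"
proof -
  let ?B = "E - M"
  obtain e where e: "e \<in> ?B"
    using assms(3) by blast
  then obtain x y where xy: "e = {x, y}" "x \<noteq> y"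
    using assms(2) by (metis DiffD1 card_2_iff)
  define R where "R = {z. reachable ?B x z}"
  have closed: "f \<subseteq> R" if f: "f \<in> ?B" "f \<inter> R \<noteq> {}" for f
  proof -
    obtain z w where "f = {z, w}"
      using assms(2) f by (metis DiffD1 card_2_iff)
    then have "(z, w) \<in> {(u, v). {u, v} \<in> ?B}" "(w, z) \<in> {(u, v). {u, v} \<in> ?B}"
      using f by (auto simp: insert_commute)
    then show ?thesis
      using f(2) \<open>f = {z, w}\<close> unfolding R_def by (auto intro: rtrancl.rtrancl_into_rtrancl)
  qed
  define A where "A = {f \<in> ?B. f \<subseteq> R}"
  have "x \<in> R"
    unfolding R_def by simp
  then have "e \<in> A"
    using closed[of e] e xy unfolding A_def by auto
  moreover have "E - A \<noteq> {}"
    using assms(3,4) unfolding A_def by blast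
  ultimately obtain a b where ab: "a \<noteq> b" "{a, b} \<subseteq> \<Union>A \<inter> \<Union>(E - A)"
    using assms(1)[unfolded nonseparable_def, rule_format, of A "E - A"] unfolding A_def by blast
  have inM: "z \<in> \<Union>M" if z: "z \<in> \<Union>A \<inter> \<Union>(E - A)" for z
  proof -
    obtain f where f: "f \<in> E" "f \<notin> A" "z \<in> f"
      using z by blast
    moreover have "z \<in> R"
      using z unfolding A_def by blast
    ultimately have "f \<in> M"
      using closed[of f] unfolding A_def by blast
    then show ?thesis
      using f by blast
  qed
  have xa: "reachable ?B x a" and xb: "reachable ?B x b"
    using ab(2) unfolding A_def R_def by auto
  have "reachable ?B a b"
    by (rule rtrancl_trans[OF reachable_sym[OF xa] xb])
  moreover have "a \<in> \<Union>M" "b \<in> \<Union>M"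
    using inM ab(2) by simp_all
  moreover have "\<forall>e\<in>?B. card e = 2"
    using assms(2) by simp
  ultimately show thesis
    using reachable_between_imp_ear[where B = ?B and a = a and b = b and X = "\<Union>M"] ab(1) that by metis
qed

section \<open>Boundaries of faces and Euler's formula\<close>

locale plane_graph =
  fixes V :: "'v set" and E :: "'v set set" and p :: "'v \<Rightarrow> complex" and \<gamma> :: "'v set \<Rightarrow> real \<Rightarrow> complex"
  assumes simple: "simple_graph (V, E)" and drawing: "plane_drawing (V, E) p \<gamma>"
begin

definition trace :: "'v set set \<Rightarrow> complex set" where
  "trace M = (\<Union>e\<in>M. path_image (\<gamma> e))"

lemma finite_V: "finite V" and edge_subset: "e \<in> E \<Longrightarrow> e \<subseteq> V" and edge_card: "e \<in> E \<Longrightarrow> card e = 2"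
  using simple unfolding simple_graph_def by auto

lemma finite_E: "finite E"
  by (rule finite_subset[of _ "Pow V"]) (use finite_V edge_subset in auto)

lemma edge_ends:
  assumes "e \<in> E"
  shows "arc (\<gamma> e)" "{pathstart (\<gamma> e), pathfinish (\<gamma> e)} = p ` e" "path_image (\<gamma> e) \<inter> p ` V = p ` e"
  using assms drawing unfolding plane_drawing_def by auto

lemma edge_Int: "e \<in> E \<Longrightarrow> f \<in> E \<Longrightarrow> e \<noteq> f \<Longrightarrow> path_image (\<gamma> e) \<inter> path_image (\<gamma> f) = p ` (e \<inter> f)"
  using drawing unfolding plane_drawing_def by auto

lemma inj_p: "inj_on p V"
  using drawing unfolding plane_drawing_def by auto

lemma vertex_in_edge: "e \<in> E \<Longrightarrow> v \<in> e \<Longrightarrow> p v \<in> path_image (\<gamma> e)"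
  using edge_ends(3)[of e] by blast

lemma edge_arc:
  assumes "{u, v} \<in> E"
  shows "arc_between (p u) (p v) (path_image (\<gamma> {u, v}))"
proof -
  have "arc_between (pathstart (\<gamma> {u, v})) (pathfinish (\<gamma> {u, v})) (path_image (\<gamma> {u, v}))"
    unfolding arc_between_def using edge_ends(1)[OF assms] by blast
  then show ?thesis
    using edge_ends(2)[OF assms] arc_between_sym by (fastforce simp: doubleton_eq_iff)
qed

lemma trace_Un: "trace (M \<union> N) = trace M \<union> trace N"
  unfolding trace_def by blast

lemma trace_mono: "M \<subseteq> N \<Longrightarrow> trace M \<subseteq> trace N"
  unfolding trace_def by blast

lemma trace_Int:
  assumes "M \<subseteq> E" "N \<subseteq> E" "M \<inter> N = {}"
  shows "trace M \<inter> trace N = p ` (\<Union>M \<inter> \<Union>N)"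
proof
  show "trace M \<inter> trace N \<subseteq> p ` (\<Union>M \<inter> \<Union>N)"
  proof
    fix x assume "x \<in> trace M \<inter> trace N"
    then obtain e f where ef: "e \<in> M" "f \<in> N" "x \<in> path_image (\<gamma> e)" "x \<in> path_image (\<gamma> f)"
      unfolding trace_def by auto
    then have "x \<in> p ` (e \<inter> f)"
      using edge_Int[of e f] assms by auto
    then show "x \<in> p ` (\<Union>M \<inter> \<Union>N)"
      using ef by auto
  qed
  show "p ` (\<Union>M \<inter> \<Union>N) \<subseteq> trace M \<inter> trace N"
    using vertex_in_edge assms unfolding trace_def by auto blast+
qed

lemma vertex_in_trace:
  assumes "M \<subseteq> E" "v \<in> V"
  shows "p v \<in> trace M \<longleftrightarrow> v \<in> \<Union>M"
proof
  assume "p v \<in> trace M"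
  then obtain e where e: "e \<in> M" "p v \<in> path_image (\<gamma> e)"
    unfolding trace_def by auto
  then have "p v \<in> p ` e"
    using edge_ends(3)[of e] assms by blast
  then have "v \<in> e"
    using inj_on_image_mem_iff[OF inj_p assms(2)] edge_subset[of e] assms e(1) by auto
  then show "v \<in> \<Union>M"
    using e by blast
qed (use assms vertex_in_edge in \<open>auto simp: trace_def\<close>)

lemma compact_trace: "M \<subseteq> E \<Longrightarrow> compact (trace M)"
  unfolding trace_def using finite_subset[OF _ finite_E] edge_ends(1) compact_arc_image
  by (intro compact_UN) auto

lemma path_trace_arc:
  assumes "distinct (a # us @ [b])" "path_edges (a # us @ [b]) \<subseteq> E"
  shows "arc_between (p a) (p b) (trace (path_edges (a # us @ [b])))"
  using assms
proof (induction us arbitrary: a)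
  case Nil
  then show ?case
    using edge_arc[of a b] by (simp add: trace_def)
next
  case (Cons c us)
  have no: "{a, c} \<notin> path_edges (c # us @ [b])"
    using path_edges_subset[of "{a, c}" "c # us @ [b]"] Cons(2) by auto
  have "\<Union>{{a, c}} \<inter> \<Union>(path_edges (c # us @ [b])) = {c}"
    using Cons(2) unfolding Union_path_edges_between by auto
  then have "trace {{a, c}} \<inter> trace (path_edges (c # us @ [b])) = {p c}"
    using trace_Int[of "{{a, c}}" "path_edges (c # us @ [b])"] Cons(3) no by simp
  moreover have "arc_between (p a) (p c) (trace {{a, c}})"
    using edge_arc[of a c] Cons(3) by (simp add: trace_def)
  moreover have "arc_between (p c) (p b) (trace (path_edges (c # us @ [b])))"
    using Cons by simp
  ultimately have "arc_between (p a) (p b) (trace {{a, c}} \<union> trace (path_edges (c # us @ [b])))"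
    by (rule arc_between_join[rotated 2])
  then show ?case
    using trace_Un[of "{{a, c}}" "path_edges (c # us @ [b])"] by simp
qed

lemma two_paths_trace_Int:
  assumes "distinct (a # b # us @ ws)" "us @ ws \<noteq> []"
    "path_edges (a # us @ [b]) \<subseteq> E" "path_edges (a # ws @ [b]) \<subseteq> E"
  shows "trace (path_edges (a # us @ [b])) \<inter> trace (path_edges (a # ws @ [b])) = {p a, p b}"
proof -
  have "\<Union>(path_edges (a # us @ [b])) \<inter> \<Union>(path_edges (a # ws @ [b])) = {a, b}"
    using assms(1) unfolding Union_path_edges_between by auto
  then show ?thesis
    using trace_Int[OF assms(3,4) path_edges_between_disjoint[OF assms(1,2)]] by simp
qed

text \<open>\<open>M\<close> is drawn such that every face \<open>U\<close> is bounded by the cycle \<open>cyc U\<close>. The last conjunct is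
  Euler's formula; it is a part of the notion because it is proved along with the others when an
  ear is added.\<close>

definition face_cycles :: "'v set set \<Rightarrow> (complex set \<Rightarrow> 'v set set) \<Rightarrow> bool" where
  "face_cycles M cyc \<longleftrightarrow>
     (\<forall>U\<in>components (- trace M). graph_cycle (cyc U) \<and> cyc U \<subseteq> M \<and> frontier U = trace (cyc U)) \<and>
     (\<forall>e\<in>M. card {U \<in> components (- trace M). e \<in> cyc U} \<le> 2) \<and>
     finite (components (- trace M)) \<and>
     card (components (- trace M)) + card (\<Union>M) = card M + 2"

text \<open>The base case is the Jordan curve theorem: both faces of a cycle are bounded by the cycle.\<close>

lemma face_cycles_cycle:
  assumes "graph_cycle C" "C \<subseteq> E"
  shows "face_cycles C (\<lambda>_. C)"
proof -
  obtain zs where zs: "3 \<le> length zs" "distinct zs" "C = path_edges (zs @ [hd zs])"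
    using assms(1) unfolding graph_cycle_def by blast
  have UC: "\<Union>C = set zs"
    using Union_path_edges[of "zs @ [hd zs]"] zs by (cases zs) auto
  obtain a b rs where "zs = a # b # rs"
    using zs(1) by (cases zs rule: path_edges.cases) auto
  then have "a \<in> \<Union>C" "b \<in> \<Union>C" "a \<noteq> b"
    using UC zs(2) by auto
  then obtain us ws where uw: "distinct (a # b # us @ ws)" "us @ ws \<noteq> []"
    "C = path_edges (a # us @ [b]) \<union> path_edges (a # ws @ [b])"
    using graph_cycle_split[OF assms(1)] by metis
  let ?A = "path_edges (a # us @ [b])" and ?B = "path_edges (a # ws @ [b])"
  have E: "?A \<subseteq> E" "?B \<subseteq> E"
    using uw(3) assms(2) by auto
  have d: "distinct (a # us @ [b])" "distinct (a # ws @ [b])"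
    using uw(1) by auto
  obtain X Y where XY: "components (- (trace ?A \<union> trace ?B)) = {X, Y}" "X \<noteq> Y"
    "frontier X = trace ?A \<union> trace ?B" "frontier Y = trace ?A \<union> trace ?B"
    by (rule two_arcs_components[OF path_trace_arc[OF d(1) E(1)] path_trace_arc[OF d(2) E(2)]
          two_paths_trace_Int[OF uw(1,2) E]])
  have tC: "trace C = trace ?A \<union> trace ?B"
    using uw(3) trace_Un by simp
  have comp: "components (- trace C) = {X, Y}"
    unfolding tC by (rule XY(1))
  have two: "{U. U = X \<or> U = Y} = {X, Y}" "card {X, Y} = 2"
    using XY(2) by auto
  have "card (\<Union>C) = card C"
    using UC card_closed_seq_edges[OF zs(1,2)] zs(2,3) distinct_card by metis
  then show ?thesis
    unfolding face_cycles_def comp using assms(1) XY(3,4) tC two by simp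
qed

text \<open>Without its ends, the drawn ear is connected and avoids \<open>M\<close>, so it lies in one face \<open>U0\<close>.
  Its ends are limits of this face, hence vertices of the boundary cycle of \<open>U0\<close>, which they
  divide into two paths \<open>P1\<close> and \<open>P2\<close>. By \<open>theta_split\<close>, the face \<open>U0\<close> is replaced by two faces
  with the boundaries \<open>P1 \<union> P\<close> and \<open>P2 \<union> P\<close>. The number of faces grows by one, and so does the
  number of edges minus the number of vertices.\<close>

lemma face_cycles_ear:
  assumes M: "face_cycles M cyc" "M \<subseteq> E"
    and ab: "a \<in> \<Union>M" "b \<in> \<Union>M"
    and us: "distinct (a # b # us)" "set us \<inter> \<Union>M = {}"
    and P: "path_edges (a # us @ [b]) \<subseteq> E - M"
  shows "\<exists>cyc'. face_cycles (M \<union> path_edges (a # us @ [b])) cyc'"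
proof -
  define P where "P = path_edges (a # us @ [b])"
  define C where "C = trace P"
  define K where "K = components (- trace M)"
  have PE: "P \<subseteq> E" and MP: "M \<inter> P = {}"
    using assms(7) unfolding P_def by auto
  have UP: "\<Union>P = insert a (insert b (set us))"
    unfolding P_def by (rule Union_path_edges_between)
  have fc: "graph_cycle (cyc U)" "cyc U \<subseteq> M" "frontier U = trace (cyc U)" if "U \<in> K" for U
    using M(1) that unfolding face_cycles_def K_def by auto
  have le2: "card {U \<in> K. e \<in> cyc U} \<le> 2" if "e \<in> M" for e
    using M(1) that unfolding face_cycles_def K_def by auto
  have finK: "finite K" and euler: "card K + card (\<Union>M) = card M + 2"
    using M(1) unfolding face_cycles_def K_def by auto
  have abV: "a \<in> V" "b \<in> V"
    using ab M(2) edge_subset by auto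
  have arcC: "arc_between (p a) (p b) C"
    unfolding C_def P_def using path_trace_arc[of a us b] us(1) PE unfolding P_def by auto
  note C = arc_between_facts[OF arcC]
  have MC: "trace M \<inter> C = {p a, p b}"
  proof -
    have "\<Union>M \<inter> \<Union>P = {a, b}"
      using ab us(2) unfolding UP by auto
    then show ?thesis
      unfolding C_def using trace_Int[OF M(2) PE MP] by simp
  qed
  obtain x where x: "x \<in> C - {p a, p b}"
    using C(7) by (meson all_not_in_conv)
  define U0 where "U0 = connected_component_set (- trace M) x"
  have CM: "C - {p a, p b} \<subseteq> - trace M"
    using MC by blast
  have U0: "U0 \<in> K"
    unfolding U0_def K_def using x CM by (intro componentsI) blast
  have CU0: "C - {p a, p b} \<subseteq> U0"
    unfolding U0_def by (rule connected_component_maximal[OF x C(6) CM])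
  have cycE: "cyc U0 \<subseteq> E"
    using fc(2)[OF U0] M(2) by blast
  have on_cycle: "v \<in> \<Union>(cyc U0)" if v: "v \<in> {a, b}" for v
  proof -
    have "p v \<in> closure U0"
      using closure_mono[OF CU0] C(8,9) v by auto
    moreover have "p v \<in> trace M"
      using v ab abV vertex_in_trace[OF M(2)] by auto
    then have "p v \<notin> U0"
      using in_components_subset[OF U0[unfolded K_def]] by blast
    ultimately have "p v \<in> frontier U0"
      unfolding frontier_def using interior_subset by blast
    then show ?thesis
      using vertex_in_trace[OF cycE] fc(3)[OF U0] v abV by auto
  qed
  have "a \<in> \<Union>(cyc U0)" "b \<in> \<Union>(cyc U0)" "a \<noteq> b"
    using on_cycle us(1) by simp_all
  then obtain vs ws where vw: "distinct (a # b # vs @ ws)" "vs @ ws \<noteq> []"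
    "cyc U0 = path_edges (a # vs @ [b]) \<union> path_edges (a # ws @ [b])"
    by (rule graph_cycle_split[OF fc(1)[OF U0]])
  define P1 where "P1 = path_edges (a # vs @ [b])"
  define P2 where "P2 = path_edges (a # ws @ [b])"
  have cyc0: "cyc U0 = P1 \<union> P2"
    unfolding P1_def P2_def by (rule vw(3))
  have P12: "P1 \<subseteq> M" "P2 \<subseteq> M" "P1 \<inter> P2 = {}"
    using cyc0 fc(2)[OF U0] path_edges_between_disjoint[OF vw(1,2)] unfolding P1_def P2_def by auto
  have P12E: "P1 \<subseteq> E" "P2 \<subseteq> E"
    using P12 M(2) by auto
  have vsM: "set vs \<subseteq> \<Union>M" "set ws \<subseteq> \<Union>M"
    using Union_mono[OF P12(1)] Union_mono[OF P12(2)]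
    unfolding P1_def P2_def Union_path_edges_between by auto
  have PP: "P1 \<noteq> P" "P2 \<noteq> P" 
    using P12 MP unfolding P_def P1_def P2_def by (cases us; cases vs; cases ws; auto)+
  have ne: "vs @ us \<noteq> []" "ws @ us \<noteq> []"
    using PP unfolding P_def P1_def P2_def by auto
  have dist: "distinct (a # b # vs @ us)" "distinct (a # b # ws @ us)"
    using vw(1) us vsM by auto
  have arcs: "arc_between (p a) (p b) (trace P1)" "arc_between (p a) (p b) (trace P2)"
    unfolding P1_def P2_def using path_trace_arc vw(1) P12E unfolding P1_def P2_def by auto
  have ints: "trace P1 \<inter> trace P2 = {p a, p b}" "trace P1 \<inter> C = {p a, p b}" "trace P2 \<inter> C = {p a, p b}"
    unfolding C_def P1_def P2_def P_def
    using two_paths_trace_Int[OF vw(1,2)] two_paths_trace_Int[OF dist(1) ne(1)]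
      two_paths_trace_Int[OF dist(2) ne(2)] P12E PE unfolding P1_def P2_def P_def by auto
  have fr0: "frontier U0 = trace P1 \<union> trace P2"
    using fc(3)[OF U0] cyc0 trace_Un by simp
  have U0c: "U0 \<in> components (- (trace P1 \<union> trace P2))"
  proof (rule connected_frontier_imp_component)
    show "connected U0" "U0 \<noteq> {}"
      using U0 in_components_connected in_components_nonempty unfolding K_def by blast+
    show "U0 \<subseteq> - (trace P1 \<union> trace P2)"
      using in_components_subset[OF U0[unfolded K_def]] trace_mono[OF P12(1)] trace_mono[OF P12(2)] by blast
    show "frontier U0 \<inter> - (trace P1 \<union> trace P2) = {}"
      unfolding fr0 by blast
  qed
  obtain X Z where XZ: "open X" "open Z" "connected X" "connected Z" "X \<noteq> {}" "Z \<noteq> {}" "X \<inter> Z = {}"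
    "X \<union> Z = U0 - C" "frontier X = trace P1 \<union> C" "frontier Z = trace P2 \<union> C"
    by (rule theta_split[OF arcs arcC ints U0c CU0])
  define K' where "K' = (K - {U0}) \<union> {X, Z}"
  have disK: "U \<inter> U' = {}" if "U \<in> K" "U' \<in> K" "U \<noteq> U'" for U U'
    using components_nonoverlap[of U "- trace M" U'] that unfolding K_def by blast
  have openM: "open (- trace M)"
    using compact_trace[OF M(2)] by (simp add: compact_imp_closed open_Compl)
  have Kfacts: "open U \<and> connected U \<and> U \<noteq> {}" if "U \<in> K" for U
    using that openM open_components in_components_connected in_components_nonempty unfolding K_def by blast
  have XU: "X \<subseteq> U0" "Z \<subseteq> U0"
    using XZ(8) by auto
  have disX: "U \<inter> X = {}" "U \<inter> Z = {}" if "U \<in> K - {U0}" for U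
    using disK[OF _ U0, of U] that XU by blast+
  have notin: "X \<notin> K - {U0}" "Z \<notin> K - {U0}" "X \<noteq> Z"
    using disX[of X] disX[of Z] XZ(5,6,7) by auto
  have "\<Union>K = - trace M"
    unfolding K_def by simp
  then have "\<Union>(K - {U0}) = - trace M - U0"
    using disK[OF _ U0] U0 by auto
  then have "\<Union>K' = (- trace M - U0) \<union> (U0 - C)"
    unfolding K'_def using XZ(8) by auto
  also have "\<dots> = - trace (M \<union> P)"
  proof -
    have "U0 \<subseteq> - trace M"
      using in_components_subset[OF U0[unfolded K_def]] .
    moreover have "C \<subseteq> trace M \<union> U0"
      using CU0 MC by blast
    ultimately show ?thesis
      unfolding trace_Un C_def[symmetric] by blast
  qed
  finally have UK': "\<Union>K' = - trace (M \<union> P)" .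
  have "components (\<Union>K') = K'"
  proof (rule components_Union_open)
    show "pairwise disjnt K'"
      unfolding K'_def pairwise_def disjnt_def using disK disX XZ(7) by (auto simp: Int_commute)
    show "open U \<and> connected U \<and> U \<noteq> {}" if "U \<in> K'" for U
      using that Kfacts XZ(1-6) unfolding K'_def by auto
  qed
  then have comp: "components (- trace (M \<union> P)) = K'"
    unfolding UK' .
  define cyc' where "cyc' = cyc(X := P1 \<union> P, Z := P2 \<union> P)"
  have cX: "cyc' X = P1 \<union> P" "cyc' Z = P2 \<union> P" and cU: "U \<in> K - {U0} \<Longrightarrow> cyc' U = cyc U" for U
    using notin unfolding cyc'_def by auto
  have gc: "graph_cycle (P1 \<union> P)" "graph_cycle (P2 \<union> P)"
    unfolding P1_def P2_def P_def
    using graph_cycle_paths[OF dist(1) ne(1)] graph_cycle_paths[OF dist(2) ne(2)] by auto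
  have 1: "graph_cycle (cyc' U) \<and> cyc' U \<subseteq> M \<union> P \<and> frontier U = trace (cyc' U)" if "U \<in> K'" for U
  proof -
    consider "U = X" | "U = Z" | "U \<in> K - {U0}"
      using \<open>U \<in> K'\<close> unfolding K'_def by blast
    then show ?thesis
    proof cases
      case 1
      then show ?thesis
        using cX gc XZ(9) P12 trace_Un[of P1 P] unfolding C_def by auto
    next
      case 2
      then show ?thesis
        using cX gc XZ(10) P12 trace_Un[of P2 P] unfolding C_def by auto
    next
      case 3
      then show ?thesis
        using cU[OF 3] fc[of U] by auto
    qed
  qed
  have 2: "card {U \<in> K'. e \<in> cyc' U} \<le> 2" if e: "e \<in> M \<union> P" for e
  proof (cases "e \<in> P")
    case True
    then have "e \<notin> cyc U" if "U \<in> K" for U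
      using fc(2)[OF that] MP by blast
    then have "{U \<in> K'. e \<in> cyc' U} \<subseteq> {X, Z}"
      using cU unfolding K'_def by auto
    then have "card {U \<in> K'. e \<in> cyc' U} \<le> card {X, Z}"
      by (intro card_mono) auto
    then show ?thesis
      using notin(3) by simp
  next
    case False
    then have eM: "e \<in> M"
      using e by blast
    let ?S = "{U \<in> K. e \<in> cyc U}"
    have fS: "finite ?S"
      using finK by simp
    show ?thesis
    proof (cases "e \<in> cyc U0")
      case True
      \<comment> \<open>The edge loses the face \<open>U0\<close> and gains the one of the two new faces whose boundary contains it.\<close>
      have "\<exists>Y. {U \<in> K'. e \<in> cyc' U} \<subseteq> insert Y (?S - {U0})"
      proof (cases "e \<in> P1")
        case True
        then have "e \<notin> P2"
          using P12 by blast
        then have "{U \<in> K'. e \<in> cyc' U} \<subseteq> insert X (?S - {U0})"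
          using \<open>e \<notin> P\<close> cX cU unfolding K'_def by auto
        then show ?thesis by blast
      next
        case False
        then have "{U \<in> K'. e \<in> cyc' U} \<subseteq> insert Z (?S - {U0})"
          using \<open>e \<notin> P\<close> cX cU unfolding K'_def by auto
        then show ?thesis by blast
      qed
      then obtain Y where "{U \<in> K'. e \<in> cyc' U} \<subseteq> insert Y (?S - {U0})"
        by blast
      then have "card {U \<in> K'. e \<in> cyc' U} \<le> card (insert Y (?S - {U0}))"
        using fS by (intro card_mono) auto
      also have "\<dots> \<le> Suc (card (?S - {U0}))"
        by (rule card_insert_le_m1) (use fS in auto)
      also have "\<dots> = card ?S"
        using card.remove[OF fS, of U0] U0 True by simp
      finally show ?thesis
        using le2[OF eM] by simp
    next
      case False
      then have "{U \<in> K'. e \<in> cyc' U} \<subseteq> ?S"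
        using \<open>e \<notin> P\<close> cX cU cyc0 unfolding K'_def by auto
      then have "card {U \<in> K'. e \<in> cyc' U} \<le> card ?S"
        by (rule card_mono[OF fS])
      then show ?thesis
        using le2[OF eM] by simp
    qed
  qed
  have fK': "finite K'"
    unfolding K'_def using finK by simp
  have cK': "card K' = card K + 1"
  proof -
    have "card K' = card (K - {U0}) + card {X, Z}"
      unfolding K'_def by (rule card_Un_disjoint) (use finK notin in auto)
    then show ?thesis
      using card.remove[OF finK U0] notin(3) by simp
  qed
  have "finite M"
    using finite_subset[OF M(2) finite_E] .
  have cMP: "card (M \<union> P) = card M + length us + 1"
    using card_Un_disjoint[OF \<open>finite M\<close> _ MP] card_path_edges[of "a # us @ [b]"] us(1) finite_path_edges
    unfolding P_def by auto
  have "finite (\<Union>M)"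
    using M(2) edge_subset finite_V by (meson Sup_le_iff finite_subset subsetD)
  have "\<Union>(M \<union> P) = \<Union>M \<union> set us"
    using UP ab by auto
  then have cV: "card (\<Union>(M \<union> P)) = card (\<Union>M) + length us"
    using card_Un_disjoint[OF \<open>finite (\<Union>M)\<close>, of "set us"] us distinct_card[of us] by auto
  have "face_cycles (M \<union> P) cyc'"
    unfolding face_cycles_def comp using 1 2 fK' cK' cMP cV euler by simp
  then show ?thesis
    unfolding P_def by blast
qed

text \<open>Take a maximal subgraph all of whose faces are bounded by cycles. One exists because an
  edge of \<open>N\<close>, not being all of \<open>N\<close>, has an ear, which closes it to a cycle. It is all of \<open>N\<close>, as
  otherwise another ear could be added.\<close>

lemma nonseparable_face_cycles:
  assumes "nonseparable N" "N \<subseteq> E" "2 \<le> card N"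
  obtains cyc where "face_cycles N cyc"
proof -
  have card2: "\<forall>e\<in>N. card e = 2"
    using assms(2) edge_card by auto
  have finN: "finite N"
    using finite_subset[OF assms(2) finite_E] .
  define \<M> where "\<M> = {M. M \<subseteq> N \<and> M \<noteq> {} \<and> (\<exists>cyc. face_cycles M cyc)}"
  obtain e where e: "e \<in> N"
    using assms(3) by fastforce
  have "{e} \<subset> N"
    using e assms(3) by (metis card_1_singleton_iff insert_subset not_less_eq_eq numeral_2_eq_2 One_nat_def order_refl psubsetI bot_least)
  then obtain c d us where cd: "c \<in> \<Union>{e}" "d \<in> \<Union>{e}" "distinct (c # d # us)" "path_edges (c # us @ [d]) \<subseteq> N - {e}"
    using nonseparable_ear[OF assms(1) card2, of "{e}"] by (metis insert_not_empty)
  have "{c, d} = e"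
    using cd card2 e by (intro card_seteq) (auto simp: card_gt_0_iff intro: card_ge_0_finite)
  then have us: "us \<noteq> []"
    using cd by auto
  define C where "C = path_edges (c # us @ [d]) \<union> path_edges (c # [] @ [d])"
  have C: "graph_cycle C"
    unfolding C_def by (rule graph_cycle_paths) (use cd us in auto)
  have CN: "C \<subseteq> N"
    unfolding C_def using cd(4) \<open>{c, d} = e\<close> e by auto
  have "face_cycles C (\<lambda>_. C)"
    by (rule face_cycles_cycle[OF C order_trans[OF CN assms(2)]])
  then have "C \<in> \<M>"
    unfolding \<M>_def using CN graph_cycle_nonempty[OF C] by auto
  moreover have "finite \<M>"
    unfolding \<M>_def using finN by simp
  ultimately obtain M where M: "M \<in> \<M>" "\<And>M'. M' \<in> \<M> \<Longrightarrow> M \<subseteq> M' \<Longrightarrow> M = M'"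
    using finite_has_maximal[of \<M>] by blast
  obtain cyc where cyc: "face_cycles M cyc" "M \<subseteq> N" "M \<noteq> {}"
    using M(1) unfolding \<M>_def by blast
  have "M = N"
  proof (rule ccontr)
    assume "M \<noteq> N"
    then have "M \<subset> N"
      using cyc by blast
    then obtain c d us where ear: "c \<in> \<Union>M" "d \<in> \<Union>M" "distinct (c # d # us)" "set us \<inter> \<Union>M = {}"
      "path_edges (c # us @ [d]) \<subseteq> N - M"
      using nonseparable_ear[OF assms(1) card2 _ cyc(3)] by metis
    have ME: "M \<subseteq> E" and PE: "path_edges (c # us @ [d]) \<subseteq> E - M"
      using cyc(2) assms(2) ear(5) by auto
    have "\<exists>cyc'. face_cycles (M \<union> path_edges (c # us @ [d])) cyc'"
      by (rule face_cycles_ear[OF cyc(1) ME ear(1-4) PE])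
    then have "M \<union> path_edges (c # us @ [d]) \<in> \<M>"
      unfolding \<M>_def using cyc ear(5) by blast
    then have "path_edges (c # us @ [d]) \<subseteq> M"
      using M(2)[of "M \<union> path_edges (c # us @ [d])"] by blast
    moreover have "path_edges (c # us @ [d]) \<noteq> {}"
      by (cases us) auto
    ultimately show False
      using ear(5) by blast
  qed
  then show thesis
    using that cyc by blast
qed

text \<open>A set of cycles counts a cycle once even if it bounds two faces. That happens only if \<open>N\<close>
  is a cycle: a face bounded by the cycle \<open>C\<close> is a whole side of \<open>C\<close>, and if both sides of \<open>C\<close> are
  faces then there is no third face. So at most one face is lost against Euler's formula.\<close>

lemma face_cycles_imp_cycle_cover:
  assumes "face_cycles N cyc" "N \<subseteq> E"
  defines "F \<equiv> cyc ` components (- trace N)"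
  shows "(\<forall>C\<in>F. graph_cycle C \<and> C \<subseteq> N) \<and> (\<forall>e\<in>N. card {C \<in> F. e \<in> C} \<le> 2) \<and>
    card N + 1 \<le> card (\<Union>N) + card F"
proof -
  define K where "K = components (- trace N)"
  have fc: "graph_cycle (cyc U)" "cyc U \<subseteq> N" "frontier U = trace (cyc U)" if "U \<in> K" for U
    using assms(1) that unfolding face_cycles_def K_def by auto
  have finK: "finite K" and euler: "card K + card (\<Union>N) = card N + 2"
    using assms(1) unfolding face_cycles_def K_def by auto
  have FK: "F = cyc ` K"
    unfolding F_def K_def ..
  have "card {C \<in> F. e \<in> C} \<le> 2" if "e \<in> N" for e
  proof -
    have "{C \<in> F. e \<in> C} = cyc ` {U \<in> K. e \<in> cyc U}"
      unfolding FK by auto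
    then have "card {C \<in> F. e \<in> C} \<le> card {U \<in> K. e \<in> cyc U}"
      using card_image_le[of "{U \<in> K. e \<in> cyc U}" cyc] finK by simp
    then show ?thesis
      using assms(1) that unfolding face_cycles_def K_def by fastforce
  qed
  moreover have "card K \<le> card F + 1"
  proof (cases "inj_on cyc K")
    case True
    then show ?thesis
      unfolding FK by (simp add: card_image)
  next
    case False
    then obtain U U' where U: "U \<in> K" "U' \<in> K" "cyc U = cyc U'" "U \<noteq> U'"
      unfolding inj_on_def by blast
    let ?C = "cyc U"
    have comp: "W \<in> components (- trace ?C)" if "W \<in> {U, U'}" for W
    proof (rule connected_frontier_imp_component)
      have W: "W \<in> K" "frontier W = trace ?C"
        using that U fc(3) by auto
      show "connected W" "W \<noteq> {}"
        using W in_components_connected in_components_nonempty unfolding K_def by blast+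
      show "W \<subseteq> - trace ?C"
        using in_components_subset[OF W(1)[unfolded K_def]] trace_mono[OF fc(2)[OF U(1)]] by blast
      show "frontier W \<inter> - trace ?C = {}"
        unfolding W(2) by blast
    qed
    have "face_cycles ?C (\<lambda>_. ?C)"
      by (rule face_cycles_cycle[OF fc(1)[OF U(1)]]) (use fc(2)[OF U(1)] assms(2) in blast)
    then have fin: "finite (components (- trace ?C))" and
      e2: "card (components (- trace ?C)) \<le> 2"
      unfolding face_cycles_def using graph_cycle_nonempty[OF fc(1)[OF U(1)]]
      by auto
    have two: "components (- trace ?C) = {U, U'}"
      using card_seteq[OF fin, of "{U, U'}"] comp e2 U(4) by auto
    have "W \<in> {U, U'}" if W: "W \<in> K" for W
    proof -
      obtain w where w: "w \<in> W" "w \<in> - trace N"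
        using in_components_nonempty in_components_subset W unfolding K_def by blast
      then have "w \<in> \<Union>(components (- trace ?C))"
        using trace_mono[OF fc(2)[OF U(1)]] by auto
      then have "w \<in> U \<or> w \<in> U'"
        unfolding two by blast
      then show ?thesis
        using components_eq[of W "- trace N"] W U(1,2) w(1) unfolding K_def by blast
    qed
    then have "card K \<le> card {U, U'}"
      by (intro card_mono) auto
    moreover have "card F > 0"
      using U(1) finK unfolding FK by (auto simp: card_gt_0_iff)
    ultimately show ?thesis
      using card_insert_le_m1[of 2 "{U'}" U] by (simp add: U(4))
  qed
  ultimately show ?thesis
    using fc euler unfolding FK by auto
qed

text \<open>If \<open>N\<close> is separable into \<open>A\<close> and \<open>B\<close>, the covers of \<open>A\<close> and \<open>B\<close> are disjoint and their
  union covers \<open>N\<close>; a common vertex is counted twice, but so is the summand 1. A single edge is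
  covered by the empty set.\<close>

theorem ex_cycle_cover:
  assumes "N \<subseteq> E" "N \<noteq> {}"
  shows "\<exists>F. (\<forall>C\<in>F. graph_cycle C \<and> C \<subseteq> N) \<and> (\<forall>e\<in>N. card {C \<in> F. e \<in> C} \<le> 2) \<and>
    card N + 1 \<le> card (\<Union>N) + card F"
  using assms
proof (induction "card N" arbitrary: N rule: less_induct)
  case less
  have finN: "finite N"
    using finite_subset[OF less(2) finite_E] .
  have finU: "finite (\<Union>N)"
    using less(2) edge_subset finite_V by (meson Sup_le_iff finite_subset subsetD)
  show ?case
  proof (cases "nonseparable N")
    case True
    show ?thesis
    proof (cases "2 \<le> card N")
      case c2: True
      obtain cyc where "face_cycles N cyc"
        using nonseparable_face_cycles[OF True less(2) c2] .
      from face_cycles_imp_cycle_cover[OF this less(2)] show ?thesis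
        by (rule exI)
    next
      case False
      have "card N \<noteq> 0"
        using less(3) finN by simp
      then have "card N = 1"
        using False by linarith
      then obtain e where "N = {e}"
        by (rule card_1_singletonE)
      then show ?thesis
        using edge_card[of e] less(2) by (intro exI[of _ "{}"]) simp
    qed
  next
    case False
    then obtain A B where AB: "A \<union> B = N" "A \<inter> B = {}" "A \<noteq> {}" "B \<noteq> {}"
      "\<not> (\<exists>a b. a \<noteq> b \<and> {a, b} \<subseteq> \<Union>A \<inter> \<Union>B)"
      unfolding nonseparable_def by blast
    have fin: "finite A" "finite B" "finite (\<Union>A)" "finite (\<Union>B)"
    proof -
      have "A \<subseteq> N" "B \<subseteq> N"
        using AB(1) by auto
      then show "finite A" "finite B" "finite (\<Union>A)" "finite (\<Union>B)"
        using finite_subset[OF _ finN] finite_subset[OF _ finU] by (simp_all add: Union_mono)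
    qed
    have cN: "card N = card A + card B"
      using card_Un_disjoint[OF fin(1,2) AB(2)] AB(1) by simp
    have pos: "0 < card A" "0 < card B"
      using AB(3,4) fin by (auto simp: card_gt_0_iff)
    obtain F where F: "\<forall>C\<in>F. graph_cycle C \<and> C \<subseteq> A" "\<forall>e\<in>A. card {C \<in> F. e \<in> C} \<le> 2"
      "card A + 1 \<le> card (\<Union>A) + card F"
      using less(1)[of A] cN pos AB(1,3) less(2) by auto
    obtain H where H: "\<forall>C\<in>H. graph_cycle C \<and> C \<subseteq> B" "\<forall>e\<in>B. card {C \<in> H. e \<in> C} \<le> 2"
      "card B + 1 \<le> card (\<Union>B) + card H"
      using less(1)[of B] cN pos AB(1,4) less(2) by auto
    have "card (\<Union>A \<inter> \<Union>B) \<le> 1"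
      using AB(5) fin(3) card_le_Suc0_iff_eq[of "\<Union>A \<inter> \<Union>B"] by (metis One_nat_def bot_least finite_Int insert_subset)
    moreover have "card (\<Union>A) + card (\<Union>B) = card (\<Union>N) + card (\<Union>A \<inter> \<Union>B)"
      using card_Un_Int[OF fin(3,4)] unfolding AB(1)[symmetric] by simp
    moreover have "card (F \<union> H) = card F + card H"
    proof (rule card_Un_disjoint)
      have "F \<subseteq> Pow A" "H \<subseteq> Pow B"
        using F(1) H(1) by auto
      then show "finite F" "finite H"
        using fin by (simp_all add: finite_subset)
      show "F \<inter> H = {}"
      proof (rule equals0I)
        fix C assume "C \<in> F \<inter> H"
        then have "C \<subseteq> A \<inter> B" "C \<noteq> {}"
          using F(1) H(1) graph_cycle_nonempty[of C] by auto
        then show False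
          using AB(2) by simp
      qed
    qed
    ultimately have "card N + 1 \<le> card (\<Union>N) + card (F \<union> H)"
      using F(3) H(3) cN by linarith
    moreover have "card {C \<in> F \<union> H. e \<in> C} \<le> 2" if e: "e \<in> N" for e
    proof (cases "e \<in> A")
      case True
      then have "{C \<in> F \<union> H. e \<in> C} = {C \<in> F. e \<in> C}"
        using H(1) AB(2) by blast
      then show ?thesis
        using F(2) True by simp
    next
      case False
      then have "{C \<in> F \<union> H. e \<in> C} = {C \<in> H. e \<in> C}" "e \<in> B"
        using F(1) e AB(1) by blast+
      then show ?thesis
        using H(2) by simp
    qed
    moreover have "\<forall>C\<in>F \<union> H. graph_cycle C \<and> C \<subseteq> N"
      using F(1) H(1) AB(1) by blast
    ultimately show ?thesis
      by (intro exI[of _ "F \<union> H"]) simp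
  qed
qed

end

section \<open>Discharging\<close>

abbreviation deg :: "'v set set \<Rightarrow> 'v \<Rightarrow> nat" where
  "deg E v \<equiv> card {e \<in> E. v \<in> e}"

lemma sum_over_vertices:
  fixes h :: "'v \<Rightarrow> 'v set \<Rightarrow> real"
  assumes "finite E" "\<forall>e\<in>E. card e = 2"
  shows "(\<Sum>v\<in>\<Union>E. \<Sum>e\<in>{e \<in> E. v \<in> e}. h v e) = (\<Sum>e\<in>E. \<Sum>v\<in>e. h v e)"
proof -
  have "finite (\<Union>E)"
    using assms by (intro finite_Union) (auto intro: card_ge_0_finite)
  then have "(\<Sum>v\<in>\<Union>E. \<Sum>e\<in>{e \<in> E. v \<in> e}. h v e) = (\<Sum>e\<in>E. \<Sum>v\<in>{v \<in> \<Union>E. v \<in> e}. h v e)"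
    by (rule sum.swap_restrict[OF _ assms(1)])
  also have "\<dots> = (\<Sum>e\<in>E. \<Sum>v\<in>e. h v e)"
    by (intro sum.cong) auto
  finally show ?thesis .
qed

lemma card_le_2_cases:
  assumes "finite S" "card S \<le> 2"
  obtains "S = {}" | A where "S = {A}" | A B where "S = {A, B}" "A \<noteq> B"
proof -
  consider "card S = 0" | "card S = 1" | "card S = 2"
    using assms(2) by linarith
  then show thesis
  proof cases
    case 1
    then show ?thesis using assms(1) that(1) by simp
  next
    case 2
    then show ?thesis using that(2) by (rule card_1_singletonE)
  next
    case 3
    then show ?thesis using that(3) by (auto simp: card_2_iff)
  qed
qed

text \<open>What \<open>ex_cycle_cover\<close> provides, without reference to a drawing. From here on the members of
  \<open>F\<close> play the role of the faces.\<close>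

locale cycle_cover =
  fixes E :: "'v set set" and F :: "'v set set set"
  assumes finite_edges: "finite E"
    and card_edge: "e \<in> E \<Longrightarrow> card e = 2"
    and cycles: "C \<in> F \<Longrightarrow> graph_cycle C" "C \<in> F \<Longrightarrow> C \<subseteq> E"
    and covered_twice: "e \<in> E \<Longrightarrow> card {C \<in> F. e \<in> C} \<le> 2"
    and many_cycles: "card E + 1 \<le> card (\<Union>E) + card F"
begin

abbreviation "d \<equiv> deg E"

lemma finite_F: "finite F"
  by (rule finite_subset[of _ "Pow E"]) (use cycles finite_edges in auto)

lemma finite_cycle: "C \<in> F \<Longrightarrow> finite C"
  using cycles(2) finite_edges finite_subset by blast

text \<open>Here \<open>\<phi> C e\<close> is what the cycle \<open>C\<close> asks of its edge \<open>e\<close>, and \<open>h v e\<close> is what the vertex \<open>v\<close>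
  gives to the edge \<open>e\<close>, or takes from it if the value is negative. If no vertex gives more than
  its supply \<open>d(v) - 4\<close>, every cycle asks for at least 4 in total, and every edge can satisfy its
  cycles from its own 2 and the gifts, then \<open>4|F| \<le> 4|E| - 4|V|\<close>, contrary to \<open>many_cycles\<close>.\<close>

lemma no_discharging:
  fixes h :: "'v \<Rightarrow> 'v set \<Rightarrow> real" and \<phi> :: "'v set set \<Rightarrow> 'v set \<Rightarrow> real"
  assumes vertex: "\<And>v. v \<in> \<Union>E \<Longrightarrow> (\<Sum>e\<in>{e \<in> E. v \<in> e}. h v e) \<le> real (d v) - 4"
    and face: "\<And>C. C \<in> F \<Longrightarrow> 4 \<le> (\<Sum>e\<in>C. \<phi> C e)"
    and edge: "\<And>e. e \<in> E \<Longrightarrow> (\<Sum>C\<in>{C \<in> F. e \<in> C}. \<phi> C e) \<le> 2 + (\<Sum>v\<in>e. h v e)"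
  shows False
proof -
  have c2: "\<forall>e\<in>E. card e = 2"
    using card_edge by simp
  have "real (\<Sum>v\<in>\<Union>E. d v) = (\<Sum>v\<in>\<Union>E. \<Sum>e\<in>{e \<in> E. v \<in> e}. 1)"
    by simp
  also have "\<dots> = (\<Sum>e\<in>E. \<Sum>v\<in>e. 1)"
    by (rule sum_over_vertices[OF finite_edges c2])
  also have "\<dots> = 2 * real (card E)"
    using card_edge by simp
  finally have handshake: "(\<Sum>v\<in>\<Union>E. real (d v)) = 2 * real (card E)"
    by simp
  have "4 * real (card F) = (\<Sum>C\<in>F. 4)"
    by simp
  also have "\<dots> \<le> (\<Sum>C\<in>F. \<Sum>e\<in>C. \<phi> C e)"
    by (intro sum_mono face)
  also have "\<dots> = (\<Sum>C\<in>F. \<Sum>e\<in>{e \<in> E. e \<in> C}. \<phi> C e)"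
    by (intro sum.cong arg_cong2[where f = sum] refl) (use cycles(2) in auto)
  also have "\<dots> = (\<Sum>e\<in>E. \<Sum>C\<in>{C \<in> F. e \<in> C}. \<phi> C e)"
    by (rule sum.swap_restrict[OF finite_F finite_edges])
  also have "\<dots> \<le> (\<Sum>e\<in>E. 2 + (\<Sum>v\<in>e. h v e))"
    by (intro sum_mono edge)
  also have "\<dots> = 2 * real (card E) + (\<Sum>v\<in>\<Union>E. \<Sum>e\<in>{e \<in> E. v \<in> e}. h v e)"
    using sum_over_vertices[OF finite_edges c2, of h] by (simp add: sum.distrib)
  also have "\<dots> \<le> 2 * real (card E) + (\<Sum>v\<in>\<Union>E. real (d v) - 4)"
    by (intro add_left_mono sum_mono vertex)
  also have "\<dots> = 4 * real (card E) - 4 * real (card (\<Union>E))"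
    using handshake by (simp add: sum_subtractf)
  finally show False
    using many_cycles by linarith
qed

text \<open>A vertex of degree \<open>n\<close> other than 3 gives \<open>\<alpha> n\<close> to each incident edge. A vertex of degree 3
  has supply \<open>-1\<close>: it takes from its edges all that their cycles and the gifts of the other ends
  leave, and \<open>light\<close> says that this is at least 1.\<close>

lemma no_degree_discharging:
  fixes \<alpha> :: "nat \<Rightarrow> real" and \<phi> :: "'v set set \<Rightarrow> 'v set \<Rightarrow> real"
  assumes independent: "\<And>u v. {u, v} \<in> E \<Longrightarrow> d u = 3 \<Longrightarrow> d v \<noteq> 3"
    and vertex: "\<And>v. v \<in> \<Union>E \<Longrightarrow> d v \<noteq> 3 \<Longrightarrow> d v * \<alpha> (d v) \<le> real (d v) - 4"
    and face: "\<And>C. C \<in> F \<Longrightarrow> 4 \<le> (\<Sum>e\<in>C. \<phi> C e)"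
    and heavy: "\<And>u v. {u, v} \<in> E \<Longrightarrow> d u \<noteq> 3 \<Longrightarrow> d v \<noteq> 3 \<Longrightarrow>
      (\<Sum>C\<in>{C \<in> F. {u, v} \<in> C}. \<phi> C {u, v}) \<le> 2 + \<alpha> (d u) + \<alpha> (d v)"
    and light: "\<And>v. d v = 3 \<Longrightarrow>
      1 \<le> (\<Sum>e\<in>{e \<in> E. v \<in> e}. 2 + (\<Sum>w\<in>e - {v}. \<alpha> (d w)) - (\<Sum>C\<in>{C \<in> F. e \<in> C}. \<phi> C e))"
  shows False
proof -
  \<comment> \<open>For a vertex of degree 3 the value is minus the remainder of the edge, so the balance of the edge is exact.\<close>
  define h where "h = (\<lambda>v e. if d v = 3
    then - (2 + (\<Sum>w\<in>e - {v}. \<alpha> (d w)) - (\<Sum>C\<in>{C \<in> F. e \<in> C}. \<phi> C e)) else \<alpha> (d v))"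
  show False
  proof (rule no_discharging[of h \<phi>])
    fix v assume v: "v \<in> \<Union>E"
    show "(\<Sum>e\<in>{e \<in> E. v \<in> e}. h v e) \<le> real (d v) - 4"
    proof (cases "d v = 3")
      case True
      then have "(\<Sum>e\<in>{e \<in> E. v \<in> e}. h v e) = - (\<Sum>e\<in>{e \<in> E. v \<in> e}. 2 + (\<Sum>w\<in>e - {v}. \<alpha> (d w)) - (\<Sum>C\<in>{C \<in> F. e \<in> C}. \<phi> C e))"
        unfolding h_def sum_negf[symmetric] by simp
      then show ?thesis
        using light[OF True] True by simp
    next
      case False
      then show ?thesis
        using vertex[OF v False] unfolding h_def by simp
    qed
  next
    fix e assume e: "e \<in> E"
    obtain u v where uv: "e = {u, v}" "u \<noteq> v"
      using card_edge[OF e] by (auto simp: card_2_iff)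
    have minus: "{u, v} - {u} = {v}" "{u, v} - {v} = {u}"
      using uv by auto
    have sum: "(\<Sum>x\<in>e. h x e) = h u e + h v e"
      using uv by simp
    consider "d u = 3" "d v \<noteq> 3" | "d v = 3" "d u \<noteq> 3" | "d u \<noteq> 3" "d v \<noteq> 3"
      using independent[of u v] e uv by auto
    then show "(\<Sum>C\<in>{C \<in> F. e \<in> C}. \<phi> C e) \<le> 2 + (\<Sum>v\<in>e. h v e)"
    proof cases
      case 3
      then show ?thesis
        using heavy[of u v] e uv sum unfolding h_def by simp
    qed (unfold sum, simp_all add: h_def uv minus)
  qed (rule face)
qed

text \<open>A cycle through a vertex uses two of its edges, and an edge is in at most two cycles. So at
  most three cycles pass through a vertex of degree 3, and any two of them share an edge since
  they use two of three edges each.\<close>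

lemma faces_at_vertex:
  assumes "d v = 3"
  defines "Fv \<equiv> {C \<in> F. v \<in> \<Union>C}"
  shows "card Fv \<le> 3" "\<And>C C'. C \<in> Fv \<Longrightarrow> C' \<in> Fv \<Longrightarrow> C \<inter> C' \<noteq> {}"
    "(\<Sum>e\<in>{e \<in> E. v \<in> e}. \<Sum>C\<in>{C \<in> F. e \<in> C}. g C) = 2 * (\<Sum>C\<in>Fv. g C :: real)"
proof -
  let ?S = "{e \<in> E. v \<in> e}"
  have finS: "finite ?S"
    using finite_edges by simp
  have two: "card {e \<in> C. v \<in> e} = 2" if "C \<in> Fv" for C
    using that graph_cycle_degree[of C v] cycles(1) unfolding Fv_def by auto
  have eq: "(\<Sum>e\<in>?S. \<Sum>C\<in>{C \<in> F. e \<in> C}. g C) = 2 * (\<Sum>C\<in>Fv. g C)" for g :: "'v set set \<Rightarrow> real"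
  proof -
    have "(\<Sum>e\<in>?S. \<Sum>C\<in>{C \<in> F. e \<in> C}. g C) = (\<Sum>C\<in>F. \<Sum>e\<in>{e \<in> ?S. e \<in> C}. g C)"
      by (rule sum.swap_restrict[OF finS finite_F])
    also have "\<dots> = (\<Sum>C\<in>F. if v \<in> \<Union>C then 2 * g C else 0)"
    proof (rule sum.cong[OF refl])
      fix C assume C: "C \<in> F"
      then have eq: "{e \<in> ?S. e \<in> C} = {e \<in> C. v \<in> e}"
        using cycles(2)[OF C] by blast
      have "card {e \<in> C. v \<in> e} = (if v \<in> \<Union>C then 2 else 0)"
        using two[of C] C unfolding Fv_def by (auto intro: card_eq_0_iff[THEN iffD2])
      then show "(\<Sum>e\<in>{e \<in> ?S. e \<in> C}. g C) = (if v \<in> \<Union>C then 2 * g C else 0)"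
        unfolding eq by simp
    qed
    also have "\<dots> = (\<Sum>C\<in>Fv. 2 * g C)"
      unfolding Fv_def by (rule sum.inter_filter[OF finite_F, symmetric])
    finally show ?thesis
      by (simp add: sum_distrib_left)
  qed
  show "(\<Sum>e\<in>?S. \<Sum>C\<in>{C \<in> F. e \<in> C}. g C) = 2 * (\<Sum>C\<in>Fv. g C :: real)"
    by (rule eq)
  have "2 * real (card Fv) = (\<Sum>e\<in>?S. real (card {C \<in> F. e \<in> C}))"
    using eq[of "\<lambda>_. 1"] by simp
  also have "\<dots> \<le> (\<Sum>e\<in>?S. 2)"
    using covered_twice by (intro sum_mono) force
  finally show "card Fv \<le> 3"
    using assms(1) by simp
  show "C \<inter> C' \<noteq> {}" if C: "C \<in> Fv" "C' \<in> Fv" for C C'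
  proof
    assume "C \<inter> C' = {}"
    then have "{e \<in> C. v \<in> e} \<inter> {e \<in> C'. v \<in> e} = {}"
      by blast
    moreover have "finite {e \<in> C. v \<in> e}" "finite {e \<in> C'. v \<in> e}"
      using C finite_cycle unfolding Fv_def by auto
    ultimately have "card ({e \<in> C. v \<in> e} \<union> {e \<in> C'. v \<in> e}) = 4"
      using card_Un_disjoint two[OF C(1)] two[OF C(2)] by fastforce
    moreover have "card ({e \<in> C. v \<in> e} \<union> {e \<in> C'. v \<in> e}) \<le> card ?S"
      using C cycles(2) unfolding Fv_def by (intro card_mono finS) auto
    ultimately show False
      using assms(1) by simp
  qed
qed

text \<open>The case where the demand \<open>f n\<close> on an edge depends only on the length \<open>n\<close> of the cycle. By
  \<open>adjacent\<close>, at most one of several pairwise adjacent cycles demands more than \<open>x\<close>, and if one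
  does then the others demand at most \<open>y\<close>. So two cycles on an edge demand at most \<open>2x\<close> or \<open>4/3 +
  y\<close>, and the values of \<open>f\<close> on the at most three cycles around a vertex of degree 3 add up to at
  most \<open>3x\<close> or \<open>4/3 + 2y\<close>. Each of these cycles charges two of the three edges at the vertex. The
  edges have \<open>3(2 + a)\<close>, of which 1 has to remain for the vertex, so half of \<open>3(2 + a) - 1\<close> is the
  bound for the sum.\<close>

lemma no_length_discharging:
  fixes f \<alpha> :: "nat \<Rightarrow> real" and x y s a :: real
  assumes independent: "\<And>u v. {u, v} \<in> E \<Longrightarrow> d u = 3 \<Longrightarrow> d v \<noteq> 3"
    and vertex: "\<And>v. v \<in> \<Union>E \<Longrightarrow> d v \<noteq> 3 \<Longrightarrow> d v * \<alpha> (d v) \<le> real (d v) - 4"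
    and demand: "\<And>C. C \<in> F \<Longrightarrow> 4 \<le> card C * f (card C)"
    and heavy: "\<And>u v. {u, v} \<in> E \<Longrightarrow> d u \<noteq> 3 \<Longrightarrow> d v \<noteq> 3 \<Longrightarrow> s \<le> \<alpha> (d u) + \<alpha> (d v)"
    and light: "\<And>u v. {u, v} \<in> E \<Longrightarrow> d u = 3 \<Longrightarrow> a \<le> \<alpha> (d v)"
    and le: "\<And>C. C \<in> F \<Longrightarrow> f (card C) \<le> 4 / 3"
    and adjacent: "\<And>C C'. C \<in> F \<Longrightarrow> C' \<in> F \<Longrightarrow> C \<noteq> C' \<Longrightarrow> C \<inter> C' \<noteq> {} \<Longrightarrow>
      f (card C) \<le> x \<or> f (card C') \<le> y"
    and bounds: "0 \<le> y" "y \<le> x" "x \<le> 4 / 3" "0 \<le> s" "2 * x \<le> 2 + s" "4 / 3 + y \<le> 2 + s"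
      "3 * x \<le> 3 + (3 * a - 1) / 2" "4 / 3 + 2 * y \<le> 3 + (3 * a - 1) / 2"
  shows False
proof (rule no_degree_discharging[of \<alpha> "\<lambda>C _. f (card C)", OF independent vertex])
  fix C assume "C \<in> F"
  then show "4 \<le> (\<Sum>e\<in>C. f (card C))"
    using demand by simp
next
  fix u v assume uv: "{u, v} \<in> E" "d u \<noteq> 3" "d v \<noteq> 3"
  have fin: "finite {C \<in> F. {u, v} \<in> C}"
    using finite_F by simp
  have "(\<Sum>C\<in>{C \<in> F. {u, v} \<in> C}. f (card C)) \<le> 2 + s"
    using fin covered_twice[OF uv(1)]
  proof (cases rule: card_le_2_cases)
    case 1
    then show ?thesis
      using bounds(4) by (simp only: sum.empty)
  next
    case (2 A)
    then have "A \<in> F"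
      by blast
    then show ?thesis
      using le[of A] bounds(1,6) by (simp add: 2)
  next
    case (3 A B)
    then have "A \<in> F" "B \<in> F" "A \<inter> B \<noteq> {}"
      by auto
    moreover from this have "B \<inter> A \<noteq> {}"
      by blast
    ultimately have "f (card A) \<le> x \<or> f (card B) \<le> y" "f (card B) \<le> x \<or> f (card A) \<le> y"
      using adjacent 3(2) by metis+
    then have "f (card A) + f (card B) \<le> 2 + s"
      using le[OF \<open>A \<in> F\<close>] le[OF \<open>B \<in> F\<close>] bounds by linarith
    then show ?thesis
      using 3(2) by (simp add: 3(1))
  qed
  then show "(\<Sum>C\<in>{C \<in> F. {u, v} \<in> C}. f (card C)) \<le> 2 + \<alpha> (d u) + \<alpha> (d v)"
    using heavy[OF uv] by simp
next
  fix v assume v: "d v = 3"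
  define Fv where "Fv = {C \<in> F. v \<in> \<Union>C}"
  note fv = faces_at_vertex[OF v, folded Fv_def]
  have finFv: "finite Fv"
    unfolding Fv_def using finite_F by simp
  have total: "(\<Sum>C\<in>Fv. f (card C)) \<le> 3 + (3 * a - 1) / 2"
  proof (cases "\<forall>C\<in>Fv. f (card C) \<le> x")
    case True
    then have "(\<Sum>C\<in>Fv. f (card C)) \<le> real (card Fv) * x"
      by (intro sum_bounded_above) auto
    also have "\<dots> \<le> 3 * x"
      using fv(1) bounds(1,2) by (intro mult_right_mono) auto
    finally show ?thesis
      using bounds(7) by simp
  next
    case False
    then obtain C where C: "C \<in> Fv" "\<not> f (card C) \<le> x"
      by blast
    have "f (card C') \<le> y" if "C' \<in> Fv - {C}" for C'
      using adjacent[of C C'] fv(2)[of C C'] that C unfolding Fv_def by auto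
    then have "(\<Sum>C'\<in>Fv - {C}. f (card C')) \<le> real (card (Fv - {C})) * y"
      by (intro sum_bounded_above) auto
    also have "\<dots> \<le> 2 * y"
      using fv(1) bounds(1) C(1) finFv by (intro mult_right_mono) auto
    finally have "(\<Sum>C\<in>Fv. f (card C)) \<le> 4 / 3 + 2 * y"
      using le[of C] C(1) sum.remove[OF finFv C(1), of "\<lambda>C. f (card C)"] unfolding Fv_def by auto
    then show ?thesis
      using bounds(8) by simp
  qed
  have "a \<le> (\<Sum>w\<in>e - {v}. \<alpha> (d w))" if e: "e \<in> {e \<in> E. v \<in> e}" for e
  proof -
    obtain w where w: "e = {v, w}" "w \<noteq> v"
      using card_edge[of e] e by (auto simp: card_2_iff)
    then have "e - {v} = {w}"
      by auto
    then show ?thesis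
      using light[of v w] e w v by simp
  qed
  then have "(\<Sum>e\<in>{e \<in> E. v \<in> e}. 2 + a) \<le> (\<Sum>e\<in>{e \<in> E. v \<in> e}. 2 + (\<Sum>w\<in>e - {v}. \<alpha> (d w)))"
    by (intro sum_mono) simp
  then have received: "6 + 3 * a \<le> (\<Sum>e\<in>{e \<in> E. v \<in> e}. 2 + (\<Sum>w\<in>e - {v}. \<alpha> (d w)))"
    using v by simp
  have "2 * (\<Sum>C\<in>Fv. f (card C)) \<le> 5 + 3 * a"
    using total by (simp add: field_simps)
  with received show "1 \<le> (\<Sum>e\<in>{e \<in> E. v \<in> e}. 2 + (\<Sum>w\<in>e - {v}. \<alpha> (d w)) - (\<Sum>C\<in>{C \<in> F. e \<in> C}. f (card C)))"
    unfolding sum_subtractf fv(3) by (simp only: le_diff_eq)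
qed

lemma cycle_length: "C \<in> F \<Longrightarrow> 3 \<le> card C"
  using cycles(1)[of C] card_closed_seq_edges unfolding graph_cycle_def by force

lemma triangle_at:
  assumes "C \<in> F" "card C = 3" "v \<in> \<Union>C"
  obtains x y where "v \<noteq> x" "v \<noteq> y" "x \<noteq> y" "C = {{v, x}, {v, y}, {x, y}}"
proof -
  obtain x y ms where *: "distinct (v # x # ms @ [y])"
    "C = insert {v, x} (insert {v, y} (path_edges (x # ms @ [y])))"
    by (rule graph_cycle_at[OF cycles(1)[OF assms(1)] assms(3)])
  have no: "v \<notin> e" if "e \<in> path_edges (x # ms @ [y])" for e
    using path_edges_subset[OF that] * by auto
  have "{v, y} \<notin> path_edges (x # ms @ [y])" "{v, x} \<notin> insert {v, y} (path_edges (x # ms @ [y]))"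
    using no *(1) by (auto simp: doubleton_eq_iff)
  then have "card C = 2 + card (path_edges (x # ms @ [y]))"
    unfolding *(2) by (simp add: finite_path_edges)
  also have "\<dots> = 3 + length ms"
    using card_path_edges[of "x # ms @ [y]"] *(1) by simp
  finally have "ms = []"
    using assms(2) by simp
  then show thesis
    using that[of x y] * by auto
qed

text \<open>There is no light edge, where \<open>D\<close> stands for the maximum degree of the whole graph.\<close>

context
  fixes D :: nat
  assumes degree_le: "\<And>v. v \<in> \<Union>E \<Longrightarrow> d v \<le> D"
    and degree_sum: "\<And>u v. {u, v} \<in> E \<Longrightarrow> D + 3 \<le> d u + d v"
begin

lemma degree_ge_3:
  assumes "v \<in> \<Union>E"
  shows "3 \<le> d v"
proof -
  obtain e where "e \<in> E" "v \<in> e"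
    using assms by blast
  then obtain w where "e = {v, w}"
    using card_edge[of e] by (auto simp: card_2_iff)
  then show ?thesis
    using degree_sum[of v w] degree_le[of w] \<open>e \<in> E\<close> by fastforce
qed

lemma edge_degrees:
  assumes "{u, v} \<in> E"
  shows "d u \<le> D" "d v \<le> D" "3 \<le> d u" "3 \<le> d v" "D + 3 \<le> d u + d v"
  using degree_le[of u] degree_le[of v] degree_ge_3[of u] degree_ge_3[of v] degree_sum[OF assms] assms by auto

text \<open>Vertices of degree 3 have only neighbours of degree \<open>D \<ge> 8\<close>, which give \<open>1/2\<close> to each edge;
  this pays the deficit 1 if no cycle asks more than 1 of an edge at such a vertex. Therefore a
  triangle with a vertex of degree 3 asks for 1, 1 and 2, with the 2 on the opposite edge, both
  ends of which have degree at least 8 and make up for the excess. An edge in a triangle without a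
  vertex of degree 3 has to bear \<open>4/3\<close> and, on its other side, at most 1. The missing \<open>1/3\<close> comes
  from an end of degree at least 6, which exists because the degrees of the ends add up to at
  least 11.\<close>

lemma no_cover_without_adjacent_triangles:
  assumes "8 \<le> D"
    and adj: "\<And>C C'. C \<in> F \<Longrightarrow> C' \<in> F \<Longrightarrow> C \<noteq> C' \<Longrightarrow> C \<inter> C' \<noteq> {} \<Longrightarrow> \<not> (card C = 3 \<and> card C' = 3)"
  shows False
proof -
  define \<alpha> :: "nat \<Rightarrow> real" where
    "\<alpha> n = (if 8 \<le> n then 1 / 2 else if 6 \<le> n then 1 / 3 else if n = 5 then 1 / 6 else 0)" for n
  define \<phi> :: "'v set set \<Rightarrow> 'v set \<Rightarrow> real" where
    "\<phi> C e = (if card C \<noteq> 3 \<or> (\<exists>u\<in>e. d u = 3) then 1 else if \<exists>u\<in>\<Union>C. d u = 3 then 2 else 4 / 3)" for C e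
  show False
  proof (rule no_degree_discharging[of \<alpha> \<phi>])
    show ind: "d v \<noteq> 3" if "{u, v} \<in> E" "d u = 3" for u v
      using edge_degrees[OF that(1)] that assms(1) by linarith
    show "real (d v) * \<alpha> (d v) \<le> real (d v) - 4" if "v \<in> \<Union>E" "d v \<noteq> 3" for v
    proof -
      have "4 \<le> d v"
        using degree_ge_3[OF that(1)] that(2) by linarith
      then consider "d v = 4" | "d v = 5" | "d v = 6" | "d v = 7" | "8 \<le> d v"
        by linarith
      then show ?thesis
        unfolding \<alpha>_def by cases auto
    qed
    show "4 \<le> (\<Sum>e\<in>C. \<phi> C e)" if C: "C \<in> F" for C
    proof (cases "card C = 3")
      case False
      then have "4 \<le> card C"
        using cycle_length[OF C] by linarith
      then show ?thesis
        using False unfolding \<phi>_def by simp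
    next
      case True
      show ?thesis
      proof (cases "\<exists>u\<in>\<Union>C. d u = 3")
        case u: True
        then obtain u where u3: "u \<in> \<Union>C" "d u = 3"
          by blast
        obtain x y where xy: "u \<noteq> x" "u \<noteq> y" "x \<noteq> y" "C = {{u, x}, {u, y}, {x, y}}"
          by (rule triangle_at[OF C True u3(1)])
        have "{u, x} \<in> E" "{u, y} \<in> E"
          using cycles(2)[OF C] xy(4) by auto
        then have "d x \<noteq> 3" "d y \<noteq> 3"
          using ind u3(2) by blast+
        then have "\<phi> C {u, x} = 1" "\<phi> C {u, y} = 1" "\<phi> C {x, y} = 2"
          using True u u3(2) unfolding \<phi>_def by auto
        moreover have "(\<Sum>e\<in>C. \<phi> C e) = (\<Sum>e\<in>{{u, x}, {u, y}, {x, y}}. \<phi> C e)"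
          using xy(4) by simp
        moreover have "\<dots> = \<phi> C {u, x} + \<phi> C {u, y} + \<phi> C {x, y}"
          using xy(1-3) by (simp add: doubleton_eq_iff)
        ultimately show ?thesis
          by simp
      next
        case False
        then have "(\<Sum>e\<in>C. \<phi> C e) = (\<Sum>e\<in>C. 4 / 3)"
          using True unfolding \<phi>_def by (intro sum.cong) auto
        then show ?thesis
          using True by simp
      qed
    qed
    show "(\<Sum>C\<in>{C \<in> F. {u, v} \<in> C}. \<phi> C {u, v}) \<le> 2 + \<alpha> (d u) + \<alpha> (d v)"
      if uv: "{u, v} \<in> E" "d u \<noteq> 3" "d v \<noteq> 3" for u v
    proof -
      note deg = edge_degrees[OF uv(1)]
      have "11 \<le> d u + d v"
        using deg(5) assms(1) by linarith
      then have "6 \<le> d u \<or> 6 \<le> d v"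
        by linarith
      then have third: "1 / 3 \<le> \<alpha> (d u) + \<alpha> (d v)"
        unfolding \<alpha>_def by auto
      have no: "\<not> (\<exists>w\<in>{u, v}. d w = 3)"
        using uv by simp
      have long: "\<phi> C {u, v} = 1" if "card C \<noteq> 3" for C
        using that unfolding \<phi>_def by simp
      have tri: "\<phi> C {u, v} \<le> 1 + \<alpha> (d u) + \<alpha> (d v)" if C: "C \<in> F" "{u, v} \<in> C" "card C = 3" for C
      proof (cases "\<exists>w\<in>\<Union>C. d w = 3")
        case True
        then obtain w where w: "w \<in> \<Union>C" "d w = 3"
          by blast
        obtain x y where xy: "w \<noteq> x" "w \<noteq> y" "x \<noteq> y" "C = {{w, x}, {w, y}, {x, y}}"
          by (rule triangle_at[OF C(1,3) w(1)])
        have "{w, x} \<in> E" "{w, y} \<in> E"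
          using cycles(2)[OF C(1)] xy(4) by auto
        then have big: "8 \<le> d x" "8 \<le> d y"
          using edge_degrees(5)[of w x] edge_degrees(5)[of w y] w(2) assms(1) by linarith+
        have "w \<notin> {u, v}"
          using no w(2) by auto
        then have "{u, v} = {x, y}"
          using C(2) xy(4) by blast
        then have "8 \<le> d u" "8 \<le> d v"
          using big by (auto simp: doubleton_eq_iff)
        then show ?thesis
          unfolding \<phi>_def \<alpha>_def by simp
      next
        case False
        then show ?thesis
          using third no C(3) unfolding \<phi>_def by auto
      qed
      have fin: "finite {C \<in> F. {u, v} \<in> C}"
        using finite_F by simp
      show ?thesis
        using fin covered_twice[OF uv(1)]
      proof (cases rule: card_le_2_cases)
        case 1
        then show ?thesis
          using third by (simp only: sum.empty)
      next
        case (2 A)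
        then have "A \<in> F" "{u, v} \<in> A"
          by blast+
        then show ?thesis
          using tri[of A] long[of A] third by (cases "card A = 3") (simp_all add: 2)
      next
        case (3 A B)
        then have AB: "A \<in> F" "{u, v} \<in> A" "B \<in> F" "{u, v} \<in> B"
          by auto
        then have "\<not> (card A = 3 \<and> card B = 3)"
          using adj[of A B] 3(2) by blast
        then show ?thesis
          using tri[of A] long[of A] tri[of B] long[of B] third AB 3(2)
          by (cases "card A = 3"; cases "card B = 3") (simp_all add: 3(1))
      qed
    qed
    show "1 \<le> (\<Sum>e\<in>{e \<in> E. v \<in> e}. 2 + (\<Sum>w\<in>e - {v}. \<alpha> (d w)) - (\<Sum>C\<in>{C \<in> F. e \<in> C}. \<phi> C e))"
      if v: "d v = 3" for v
    proof -
      have "1 / 2 \<le> 2 + (\<Sum>w\<in>e - {v}. \<alpha> (d w)) - (\<Sum>C\<in>{C \<in> F. e \<in> C}. \<phi> C e)"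
        if e: "e \<in> {e \<in> E. v \<in> e}" for e
      proof -
        obtain w where w: "e = {v, w}" "w \<noteq> v"
          using card_edge[of e] e by (auto simp: card_2_iff)
        then have "e - {v} = {w}" "8 \<le> d w"
          using edge_degrees(5)[of v w] e v assms(1) by auto
        then have "(\<Sum>w\<in>e - {v}. \<alpha> (d w)) = 1 / 2"
          unfolding \<alpha>_def by simp
        moreover have "\<phi> C e = 1" for C
          using v e unfolding \<phi>_def by auto
        then have "(\<Sum>C\<in>{C \<in> F. e \<in> C}. \<phi> C e) = real (card {C \<in> F. e \<in> C})"
          by simp
        ultimately show ?thesis
          using covered_twice[of e] e by simp
      qed
      then have "(\<Sum>e\<in>{e \<in> E. v \<in> e}. 1 / 2) \<le>
        (\<Sum>e\<in>{e \<in> E. v \<in> e}. 2 + (\<Sum>w\<in>e - {v}. \<alpha> (d w)) - (\<Sum>C\<in>{C \<in> F. e \<in> C}. \<phi> C e))"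
        by (rule sum_mono)
      then show ?thesis
        using v by simp
    qed
  qed
qed

text \<open>A cycle of length \<open>n\<close> demands \<open>4/n\<close> if \<open>n \<le> 5\<close>, and \<open>4/5\<close> otherwise. An edge between a
  triangle and a cycle of length at least 5 lacks \<open>4/3 + 4/5 - 2 = 2/15\<close>, which an end of degree
  at least 5 gives; note that \<open>5 * 2/15 \<le> 1\<close>. The cycles around a vertex of degree 3 demand at
  most \<open>2 * 3\<close> or \<open>2(4/3 + 4/5 + 4/5)\<close>, no more than the 6 that its edges have, and the deficit 1
  is paid by its three neighbours of degree at least 6, which give \<open>1/3\<close> each.\<close>

lemma no_cover_without_triangle_next_to_4_cycle:
  assumes "6 \<le> D"
    and adj: "\<And>C C'. C \<in> F \<Longrightarrow> C' \<in> F \<Longrightarrow> C \<noteq> C' \<Longrightarrow> C \<inter> C' \<noteq> {} \<Longrightarrow> \<not> (card C = 3 \<and> card C' \<le> 4)"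
  shows False
proof -
  define \<alpha> :: "nat \<Rightarrow> real" where "\<alpha> n = (if 6 \<le> n then 1 / 3 else if n = 5 then 2 / 15 else 0)" for n
  define f :: "nat \<Rightarrow> real" where "f n = (if n = 3 then 4 / 3 else if n = 4 then 1 else 4 / 5)" for n
  show False
  proof (rule no_length_discharging[of \<alpha> f "2 / 15" "1 / 3" 1 "4 / 5"])
    show "real (d v) * \<alpha> (d v) \<le> real (d v) - 4" if "v \<in> \<Union>E" "d v \<noteq> 3" for v
    proof -
      have "4 \<le> d v"
        using degree_ge_3[OF that(1)] that(2) by linarith
      then consider "d v = 4" | "d v = 5" | "6 \<le> d v"
        by linarith
      then show ?thesis
        unfolding \<alpha>_def by cases auto
    qed
    show "4 \<le> real (card C) * f (card C)" if "C \<in> F" for C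
      using cycle_length[OF that] unfolding f_def by auto
    show "f (card C) \<le> 1 \<or> f (card C') \<le> 4 / 5"
      if "C \<in> F" "C' \<in> F" "C \<noteq> C'" "C \<inter> C' \<noteq> {}" for C C'
      using adj[OF that] cycle_length[OF that(2)] unfolding f_def by auto
    show "d v \<noteq> 3" if "{u, v} \<in> E" "d u = 3" for u v
      using edge_degrees(5)[OF that(1)] that(2) assms(1) by linarith
    show "2 / 15 \<le> \<alpha> (d u) + \<alpha> (d v)" if "{u, v} \<in> E" for u v
    proof -
      have "5 \<le> d u \<or> 5 \<le> d v"
        using edge_degrees(5)[OF that] assms(1) by linarith
      then show ?thesis
        unfolding \<alpha>_def by auto
    qed
    show "1 / 3 \<le> \<alpha> (d v)" if "{u, v} \<in> E" "d u = 3" for u v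
      using edge_degrees(5)[OF that(1)] that(2) assms(1) unfolding \<alpha>_def by simp
    show "f (card C) \<le> 4 / 3" for C
      unfolding f_def by simp
  qed (use assms(1) in simp_all)
qed

text \<open>Cycles of length at least 6 ask only for \<open>2/3\<close>, so an edge between one of them and a
  triangle is balanced. Around a vertex of degree 3 the demands are largest if one of the cycles
  is a triangle, and then add up to at most \<open>2(4/3 + 2/3 + 2/3) = 16/3\<close>, and the three edges have
  \<open>6 + 3/6\<close>.\<close>

lemma no_cover_without_short_next_to_5_cycle:
  assumes "5 \<le> D"
    and adj: "\<And>C C'. C \<in> F \<Longrightarrow> C' \<in> F \<Longrightarrow> C \<noteq> C' \<Longrightarrow> C \<inter> C' \<noteq> {} \<Longrightarrow> \<not> (card C \<le> 4 \<and> card C' \<le> 5)"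
  shows False
proof -
  define \<alpha> :: "nat \<Rightarrow> real" where "\<alpha> n = (if 5 \<le> n then 1 / 6 else 0)" for n
  define f :: "nat \<Rightarrow> real" where
    "f n = (if n = 3 then 4 / 3 else if n = 4 then 1 else if n = 5 then 4 / 5 else 2 / 3)" for n
  show False
  proof (rule no_length_discharging[of \<alpha> f 0 "1 / 6" "4 / 5" "2 / 3"])
    show "real (d v) * \<alpha> (d v) \<le> real (d v) - 4" if "v \<in> \<Union>E" "d v \<noteq> 3" for v
      using degree_ge_3[OF that(1)] that(2) unfolding \<alpha>_def by auto
    show "4 \<le> real (card C) * f (card C)" if "C \<in> F" for C
      using cycle_length[OF that] unfolding f_def by auto
    show "f (card C) \<le> 4 / 5 \<or> f (card C') \<le> 2 / 3"
      if "C \<in> F" "C' \<in> F" "C \<noteq> C'" "C \<inter> C' \<noteq> {}" for C C'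
      using adj[OF that] cycle_length[OF that(1)] unfolding f_def by auto
    show "d v \<noteq> 3" if "{u, v} \<in> E" "d u = 3" for u v
      using edge_degrees(5)[OF that(1)] that(2) assms(1) by linarith
    show "0 \<le> \<alpha> (d u) + \<alpha> (d v)" for u v
      unfolding \<alpha>_def by simp
    show "1 / 6 \<le> \<alpha> (d v)" if "{u, v} \<in> E" "d u = 3" for u v
      using edge_degrees(5)[OF that(1)] that(2) assms(1) unfolding \<alpha>_def by simp
    show "f (card C) \<le> 4 / 3" for C
      unfolding f_def by simp
  qed (use assms(1) in simp_all)
qed

text \<open>Here no gifts occur: cycles of length at least 8 ask only for \<open>1/2\<close>, and around a vertex of
  degree 3 the demands add up to at most \<open>2 * 3 * 4/5\<close> or \<open>2(4/3 + 1/2 + 1/2)\<close>, both less than \<open>6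
  - 1\<close>. The condition \<open>4 \<le> D\<close> keeps vertices of degree 3 nonadjacent, so that no edge is drawn
  upon from both ends.\<close>

lemma no_cover_without_short_next_to_7_cycle:
  assumes "4 \<le> D"
    and adj: "\<And>C C'. C \<in> F \<Longrightarrow> C' \<in> F \<Longrightarrow> C \<noteq> C' \<Longrightarrow> C \<inter> C' \<noteq> {} \<Longrightarrow> \<not> (card C \<le> 4 \<and> card C' \<le> 7)"
  shows False
proof -
  define f :: "nat \<Rightarrow> real" where
    "f n = (if n = 3 then 4 / 3 else if n = 4 then 1 else if n \<le> 7 then 4 / 5 else 1 / 2)" for n
  show False
  proof (rule no_length_discharging[of "\<lambda>_. 0" f 0 0 "4 / 5" "1 / 2"])
    show "4 \<le> real (card C) * f (card C)" if "C \<in> F" for C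
      using cycle_length[OF that] unfolding f_def by auto
    show "f (card C) \<le> 4 / 5 \<or> f (card C') \<le> 1 / 2"
      if "C \<in> F" "C' \<in> F" "C \<noteq> C'" "C \<inter> C' \<noteq> {}" for C C'
      using adj[OF that] cycle_length[OF that(1)] unfolding f_def by auto
    show "real (d v) * 0 \<le> real (d v) - 4" if "v \<in> \<Union>E" "d v \<noteq> 3" for v
      using degree_ge_3[OF that(1)] that(2) by simp
    show "d v \<noteq> 3" if "{u, v} \<in> E" "d u = 3" for u v
      using edge_degrees(5)[OF that(1)] that(2) assms(1) by linarith
    show "f (card C) \<le> 4 / 3" for C
      unfolding f_def by simp
  qed (use assms(1) in simp_all)
qed

end

end

section \<open>Extending edge colourings\<close>

text \<open>\<open>R e f x y\<close> means that the edges \<open>e\<close> and \<open>f\<close> may not have the colours \<open>x\<close> and \<open>y\<close> at the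
  same time. The conflicts between two edges form a matching of their lists: these are the
  correspondence colourings (DP-colourings) of line graphs, of which group colourings are a
  special case.\<close>

locale correspondence =
  fixes R :: "'v set \<Rightarrow> 'v set \<Rightarrow> 'c \<Rightarrow> 'c \<Rightarrow> bool" and L :: "'v set \<Rightarrow> 'c set"
  assumes conflict_sym: "R e f x y \<Longrightarrow> R f e y x"
    and conflict_meet: "R e f x y \<Longrightarrow> e \<noteq> f \<and> e \<inter> f \<noteq> {}"
    and conflict_unique: "R e f x y \<Longrightarrow> R e f x' y \<Longrightarrow> x \<in> L e \<Longrightarrow> x' \<in> L e \<Longrightarrow> x = x'"
begin

definition proper :: "'v set set \<Rightarrow> ('v set \<Rightarrow> 'c) \<Rightarrow> bool" where
  "proper S c \<longleftrightarrow> (\<forall>e\<in>S. c e \<in> L e) \<and> (\<forall>e\<in>S. \<forall>f\<in>S. \<not> R e f (c e) (c f))"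

definition available :: "'v set set \<Rightarrow> ('v set \<Rightarrow> 'c) \<Rightarrow> 'v set \<Rightarrow> 'c set" where
  "available S c e = {x \<in> L e. \<forall>f\<in>S. \<not> R e f x (c f)}"

abbreviation neighbours :: "'v set set \<Rightarrow> 'v set \<Rightarrow> 'v set set" where
  "neighbours S e \<equiv> {f \<in> S. f \<noteq> e \<and> f \<inter> e \<noteq> {}}"

lemma card_conflicts_le_1: "card {x \<in> L e. R e f x y} \<le> 1"
proof (cases "finite {x \<in> L e. R e f x y}")
  case True
  then show ?thesis
    using conflict_unique[of e f _ y] by (auto simp: card_le_Suc0_iff_eq)
qed simp

lemma card_available:
  assumes "finite S" "finite (L e)"
  shows "card (L e) \<le> card (available S c e) + card (neighbours S e)"
proof -
  let ?B = "\<Union>f\<in>neighbours S e. {x \<in> L e. R e f x (c f)}"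
  have fB: "finite ?B" "finite (available S c e)"
    using assms unfolding available_def by auto
  have "L e \<subseteq> available S c e \<union> ?B"
  proof
    fix x assume x: "x \<in> L e"
    show "x \<in> available S c e \<union> ?B"
    proof (cases "x \<in> available S c e")
      case False
      then obtain f where f: "f \<in> S" "R e f x (c f)"
        using x unfolding available_def by blast
      then have "f \<in> neighbours S e"
        using conflict_meet[OF f(2)] by auto
      then show ?thesis
        using x f(2) by blast
    qed simp
  qed
  then have "card (L e) \<le> card (available S c e \<union> ?B)"
    using fB by (intro card_mono) auto
  also have "\<dots> \<le> card (available S c e) + card ?B"
    by (rule card_Un_le)
  also have "card ?B \<le> (\<Sum>f\<in>neighbours S e. card {x \<in> L e. R e f x (c f)})"
    using assms(1) by (intro card_UN_le) simp
  also have "\<dots> \<le> (\<Sum>f\<in>neighbours S e. 1)"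
    by (intro sum_mono card_conflicts_le_1)
  finally show ?thesis
    by simp
qed

lemma proper_insert:
  assumes "proper S c" "x \<in> available S c e" "e \<notin> S"
  shows "proper (insert e S) (c(e := x))"
proof -
  have "\<not> R a b ((c(e := x)) a) ((c(e := x)) b)" if ab: "a \<in> insert e S" "b \<in> insert e S" for a b
  proof
    assume r: "R a b ((c(e := x)) a) ((c(e := x)) b)"
    have "a \<noteq> b"
      using conflict_meet[OF r] by simp
    then consider "a = e" "b \<in> S" "b \<noteq> e" | "b = e" "a \<in> S" "a \<noteq> e" | "a \<in> S" "b \<in> S" "a \<noteq> e" "b \<noteq> e"
      using ab by blast
    then show False
    proof cases
      case 1
      then show ?thesis
        using r assms(2) unfolding available_def by simp
    next
      case 2
      then show ?thesis
        using conflict_sym[OF r] assms(2) unfolding available_def by simp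
    next
      case 3
      then show ?thesis
        using r assms(1) unfolding proper_def by simp
    qed
  qed
  moreover have "\<forall>a\<in>insert e S. (c(e := x)) a \<in> L a"
    using assms unfolding proper_def available_def by simp
  ultimately show ?thesis
    unfolding proper_def by blast
qed

lemma greedy_extension:
  assumes "proper S c" "e \<notin> S" "finite S" "finite (L e)" "card (neighbours S e) < card (L e)"
  obtains x where "proper (insert e S) (c(e := x))"
proof -
  have "card (available S c e) \<noteq> 0"
    using card_available[OF assms(3,4), of c] assms(5) by linarith
  then obtain x where "x \<in> available S c e"
    by (metis card.empty all_not_in_conv)
  then show thesis
    using that proper_insert assms(1,2) by blast
qed

text \<open>The new colouring may differ from \<open>c\<close> on \<open>E - S\<close>.\<close>

definition reducible :: "'v set set \<Rightarrow> bool" where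
  "reducible E \<longleftrightarrow> (\<exists>S\<subseteq>E. S \<noteq> {} \<and> (\<forall>c. proper (E - S) c \<longrightarrow> (\<exists>c'. proper E c')))"

lemma colourable_if_reducible:
  assumes "finite E" "\<And>N. N \<subseteq> E \<Longrightarrow> N \<noteq> {} \<Longrightarrow> reducible N"
  shows "\<exists>c. proper E c"
  using assms
proof (induction E rule: finite_psubset_induct)
  case (psubset E)
  show ?case
  proof (cases "E = {}")
    case True
    then show ?thesis
      unfolding proper_def by simp
  next
    case False
    then obtain S where S: "S \<subseteq> E" "S \<noteq> {}" "\<And>c. proper (E - S) c \<Longrightarrow> \<exists>c'. proper E c'"
      using psubset(3)[of E] unfolding reducible_def by blast
    have "\<exists>c. proper (E - S) c"
    proof (rule psubset(2))
      show "E - S \<subset> E"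
        using S by blast
      show "reducible N" if "N \<subseteq> E - S" "N \<noteq> {}" for N
        using psubset(3)[of N] that by blast
    qed
    then show ?thesis
      using S(3) by blast
  qed
qed

lemma card_neighbours_le:
  "card (neighbours S {u, v}) \<le> card {f \<in> S. u \<in> f \<and> f \<noteq> {u, v}} + card {f \<in> S. v \<in> f \<and> f \<noteq> {u, v}}"
proof -
  have "neighbours S {u, v} = {f \<in> S. u \<in> f \<and> f \<noteq> {u, v}} \<union> {f \<in> S. v \<in> f \<and> f \<noteq> {u, v}}"
    by auto
  then show ?thesis
    by (simp add: card_Un_le)
qed

lemma card_other_edges:
  assumes "finite E" "e \<in> E" "u \<in> e"
  shows "card {f \<in> E. u \<in> f \<and> f \<noteq> e} = deg E u - 1"
proof -
  have "{f \<in> E. u \<in> f \<and> f \<noteq> e} = {f \<in> E. u \<in> f} - {e}"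
    by auto
  then show ?thesis
    using assms by (simp add: card_Diff_singleton)
qed

lemma light_edge_reducible:
  assumes "finite E" "{u, v} \<in> E" "u \<noteq> v" "finite (L {u, v})" "deg E u + deg E v \<le> card (L {u, v}) + 1"
  shows "reducible E"
proof -
  let ?e = "{u, v}"
  have "\<exists>c'. proper E c'" if c: "proper (E - {?e}) c" for c
  proof -
    have pos: "deg E u > 0" "deg E v > 0"
      using assms(1,2) by (auto simp: card_gt_0_iff)
    have "card (neighbours (E - {?e}) ?e) \<le> card (neighbours E ?e)"
      using assms(1) by (intro card_mono) auto
    also have "\<dots> \<le> (deg E u - 1) + (deg E v - 1)"
      using card_neighbours_le[of E u v] card_other_edges[OF assms(1,2)] by simp
    also have "\<dots> < card (L ?e)"
      using pos assms(5) by linarith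
    finally obtain x where "proper (insert ?e (E - {?e})) (c(?e := x))"
      using greedy_extension[OF c _ _ assms(4)] assms(1) by auto
    then show ?thesis
      using assms(2) by (metis insert_Diff)
  qed
  then show ?thesis
    unfolding reducible_def using assms(2) by (intro exI[of _ "{?e}"]) simp
qed

lemma card_coloured_neighbours_le_3:
  assumes "finite E" "{u, v} \<in> E" "deg E u = 3" "deg E v = 3"
    and "S \<subseteq> E" "g \<in> neighbours E {u, v}" "g \<notin> S"
  shows "card (neighbours S {u, v}) \<le> 3"
proof -
  have "neighbours S {u, v} \<subseteq> neighbours E {u, v} - {g}"
    using assms(5,7) by auto
  then have "card (neighbours S {u, v}) \<le> card (neighbours E {u, v} - {g})"
    using assms(1) by (intro card_mono) auto
  also have "\<dots> = card (neighbours E {u, v}) - 1"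
    using assms(1,6) by (simp add: card_Diff_singleton)
  also have "\<dots> \<le> 3"
    using card_neighbours_le[of E u v] card_other_edges[OF assms(1,2)] assms(3,4) by simp
  finally show ?thesis .
qed

text \<open>In a cubic graph with lists of size 4 an edge can be coloured as long as one of its four
  neighbours is not coloured. Along the path, the next edge of the path is such a neighbour, and
  for the last one \<open>g\<close> is.\<close>

lemma greedy_along_path:
  assumes "finite E" "\<And>v. v \<in> \<Union>E \<Longrightarrow> deg E v = 3" "\<And>e. e \<in> E \<Longrightarrow> finite (L e) \<and> card (L e) = 4"
    and "distinct (a # b # xs)" "path_edges (a # b # xs) \<subseteq> E - S" "S \<subseteq> E" "proper S c"
    and "g \<in> E - S" "g \<notin> path_edges (a # b # xs)" "last (b # xs) \<in> g"
  shows "\<exists>c'. proper (S \<union> path_edges (a # b # xs)) c' \<and> (\<forall>e\<in>S. c' e = c e)"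
  using assms(4-)
proof (induction xs arbitrary: a b S c)
  case Nil
  let ?e = "{a, b}"
  have e: "?e \<in> E" "?e \<notin> S" "finite (L ?e)" "card (L ?e) = 4"
    using Nil(2) assms(3)[of ?e] by auto
  have "deg E a = 3" "deg E b = 3"
    using assms(2)[of a] assms(2)[of b] e(1) by auto
  moreover have "g \<in> neighbours E ?e" "g \<notin> S"
    using Nil by auto
  ultimately have "card (neighbours S ?e) \<le> 3"
    using card_coloured_neighbours_le_3[OF assms(1) e(1) _ _ Nil(3)] by blast
  then obtain x where "proper (insert ?e S) (c(?e := x))"
    using greedy_extension[OF Nil(4) e(2) finite_subset[OF Nil(3) assms(1)] e(3)] e(4) by auto
  then show ?case
    using e(2) by (intro exI[of _ "c(?e := x)"]) (simp del: fun_upd_apply, auto)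
next
  case (Cons y ys)
  let ?e = "{a, b}"
  have e: "?e \<in> E" "?e \<notin> S" "finite (L ?e)" "card (L ?e) = 4"
    using Cons(3) assms(3)[of ?e] by auto
  have by_S: "{b, y} \<in> E" "{b, y} \<notin> S" "{b, y} \<noteq> {a, b}"
    using Cons(2,3) by (auto simp: doubleton_eq_iff)
  have "deg E a = 3" "deg E b = 3"
    using assms(2)[of a] assms(2)[of b] e(1) by auto
  moreover have "{b, y} \<in> neighbours E ?e"
    using by_S by auto
  ultimately have "card (neighbours S ?e) \<le> 3"
    using card_coloured_neighbours_le_3[OF assms(1) e(1) _ _ Cons(4)] by_S(2) by blast
  then obtain x where x: "proper (insert ?e S) (c(?e := x))"
    using greedy_extension[OF Cons(5) e(2) finite_subset[OF Cons(4) assms(1)] e(3)] e(4) by auto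
  have "?e \<notin> path_edges (b # y # ys)"
    using path_edges_subset[of ?e "b # y # ys"] Cons(2) by auto
  then have "\<exists>c'. proper (insert ?e S \<union> path_edges (b # y # ys)) c' \<and> (\<forall>e\<in>insert ?e S. c' e = (c(?e := x)) e)"
  proof (intro Cons(1))
    show "distinct (b # y # ys)" "last (y # ys) \<in> g" "g \<notin> path_edges (b # y # ys)"
      using Cons(2,7,8) by auto
    show "path_edges (b # y # ys) \<subseteq> E - insert ?e S"
      using Cons(3) \<open>?e \<notin> path_edges (b # y # ys)\<close> by auto
    show "g \<in> E - insert ?e S"
      using Cons(6,7) by auto
    show "proper (insert ?e S) (c(?e := x))"
      by (rule x)
  qed (use e(1) Cons(4) in simp_all)
  then obtain c' where c': "proper (insert ?e S \<union> path_edges (b # y # ys)) c'" "\<forall>e\<in>insert ?e S. c' e = (c(?e := x)) e"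
    by blast
  have "insert ?e S \<union> path_edges (b # y # ys) = S \<union> path_edges (a # b # y # ys)"
    by auto
  moreover have "\<forall>e\<in>S. c' e = c e"
    using c'(2) e(2) by auto
  ultimately show ?case
    using c'(1) by metis
qed

end

text \<open>Let \<open>v\<close> be the first vertex of a longest path. All neighbours of \<open>v\<close> are on the path, and
  there are two, \<open>w\<close> and then \<open>z\<close>, besides the second vertex \<open>u\<close>. The path from \<open>v\<close> to \<open>w\<close> and the
  edge \<open>vw\<close> form a cycle that does not contain \<open>z\<close>.\<close>

lemma cycle_with_pendant_edge:
  assumes "finite E" "\<And>e. e \<in> E \<Longrightarrow> card e = 2" "E \<noteq> {}" "\<And>v. v \<in> \<Union>E \<Longrightarrow> 3 \<le> deg E v"
  obtains v u us w z where "distinct (v # u # us @ [w, z])" "path_edges (v # u # us @ [w]) \<subseteq> E"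
    "{v, w} \<in> E" "{v, z} \<in> E"
proof -
  define paths where "paths = {xs. distinct xs \<and> path_edges xs \<subseteq> E \<and> set xs \<subseteq> \<Union>E \<and> 2 \<le> length xs}"
  have finV: "finite (\<Union>E)"
    using assms(1,2) by (intro finite_Union) (auto intro: card_ge_0_finite)
  have "length xs \<le> card (\<Union>E)" if "xs \<in> paths" for xs
    using that card_mono[OF finV, of "set xs"] distinct_card[of xs] unfolding paths_def by simp
  then have bound: "\<forall>xs. xs \<in> paths \<longrightarrow> length xs < card (\<Union>E) + 1"
    by (simp add: less_Suc_eq_le)
  obtain e where "e \<in> E"
    using assms(3) by blast
  then obtain a b where "e = {a, b}" "a \<noteq> b"
    using assms(2)[of e] by (auto simp: card_2_iff)
  then have ab: "[a, b] \<in> paths"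
    using \<open>e \<in> E\<close> unfolding paths_def by auto
  obtain xs where xs: "xs \<in> paths" "\<And>ys. ys \<in> paths \<Longrightarrow> length ys \<le> length xs"
    using ex_has_greatest_nat[of "\<lambda>xs. xs \<in> paths", OF ab bound] by blast
  then obtain v u rs where vu: "xs = v # u # rs"
    unfolding paths_def by (cases xs rule: path_edges.cases) auto
  have path: "distinct (v # u # rs)" "path_edges (v # u # rs) \<subseteq> E" "set (v # u # rs) \<subseteq> \<Union>E"
    using xs(1) vu unfolding paths_def by auto
  let ?N = "{e \<in> E. v \<in> e}"
  have on_path: "\<exists>y\<in>set rs. e = {v, y}" if e: "e \<in> ?N - {{v, u}}" for e
  proof -
    obtain y where y: "e = {v, y}" "y \<noteq> v"
      using assms(2)[of e] e by (auto simp: card_2_iff)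
    have "y \<in> set (v # u # rs)"
    proof (rule ccontr)
      assume "y \<notin> set (v # u # rs)"
      then have "y # xs \<in> paths"
        using path y e unfolding paths_def vu by (auto simp: insert_commute)
      then show False
        using xs(2)[of "y # xs"] by simp
    qed
    then show ?thesis
      using y e by auto
  qed
  have "2 \<le> card (?N - {{v, u}})"
    using assms(4)[of v] path(3) path(2) assms(1) by (simp add: card_Diff_singleton)
  then obtain e f where ef: "e \<in> ?N - {{v, u}}" "f \<in> ?N - {{v, u}}" "e \<noteq> f"
    using card_le_Suc0_iff_eq[of "?N - {{v, u}}"] assms(1) by force
  obtain y z where yz: "y \<in> set rs" "e = {v, y}" "z \<in> set rs" "f = {v, z}"
    using on_path[OF ef(1)] on_path[OF ef(2)] by blast
  have "y \<noteq> z"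
    using ef(3) yz by auto
  have "\<exists>ps w qs z. rs = ps @ w # qs \<and> z \<in> set qs \<and> {v, w} \<in> E \<and> {v, z} \<in> E"
  proof -
    obtain ps qs where 1: "rs = ps @ y # qs"
      using yz(1) by (meson split_list)
    show ?thesis
    proof (cases "z \<in> set qs")
      case True
      then show ?thesis
        using 1 ef(1,2) unfolding yz(2,4) by (intro exI[of _ ps] exI[of _ y] exI[of _ qs] exI[of _ z]) simp
    next
      case False
      then have "z \<in> set ps"
        using 1 yz(3) \<open>y \<noteq> z\<close> by auto
      then obtain p1 p2 where "ps = p1 @ z # p2"
        by (meson split_list)
      then show ?thesis
        using 1 ef(1,2) unfolding yz(2,4)
        by (intro exI[of _ p1] exI[of _ z] exI[of _ "p2 @ y # qs"] exI[of _ y]) simp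
    qed
  qed
  then obtain ps w qs z where pw: "rs = ps @ w # qs" "z \<in> set qs" "{v, w} \<in> E" "{v, z} \<in> E"
    by blast
  show thesis
  proof (rule that[of v u ps w z])
    show "distinct (v # u # ps @ [w, z])"
      using path(1) pw(1,2) by auto
    show "path_edges (v # u # ps @ [w]) \<subseteq> E"
    proof -
      have "path_edges (v # u # ps @ w # qs) = path_edges (v # u # ps @ [w]) \<union> path_edges (w # qs)"
        using path_edges_append[of "v # u # ps" w qs] by (simp only: append_Cons)
      then show ?thesis
        using path(2) unfolding pw(1) by (simp only: Un_subset_iff)
    qed
  qed (use pw in auto)
qed

context correspondence
begin

text \<open>Let \<open>c\<close> colour the set \<open>T\<close> of all edges but those of a cycle with a pendant edge \<open>vz\<close>,
  where \<open>vw\<close> and \<open>vu\<close> are the edges of the cycle at \<open>v\<close>. Then \<open>vz\<close> has two available colours, and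
  \<open>vw\<close> has three, one of which conflicts with neither of the two. With this colour on \<open>vw\<close>, the
  rest of the cycle can be coloured greedily from \<open>w\<close> to \<open>v\<close>, as every edge still has an
  uncoloured neighbour. Finally only the colour of \<open>vu\<close> can exclude one of the two colours of
  \<open>vz\<close>.\<close>

lemma cubic_reducible:
  assumes fin: "finite E" and card2: "\<And>e. e \<in> E \<Longrightarrow> card e = 2" and ne: "E \<noteq> {}"
    and cubic: "\<And>v. v \<in> \<Union>E \<Longrightarrow> deg E v = 3"
    and lists: "\<And>e. e \<in> E \<Longrightarrow> finite (L e) \<and> card (L e) = 4"
  shows "reducible E"
proof -
  have "3 \<le> deg E v" if "v \<in> \<Union>E" for v
    using cubic[OF that] by simp
  from cycle_with_pendant_edge[OF fin card2 ne this]
  obtain v u us w z where dist: "distinct (v # u # us @ [w, z])"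
    and path: "path_edges (v # u # us @ [w]) \<subseteq> E" and vw: "{v, w} \<in> E" and vz: "{v, z} \<in> E" .
  define P where "P = path_edges (w # rev (u # us) @ [v])"
  have P: "P = path_edges (v # u # us @ [w])"
    unfolding P_def using path_edges_rev_between[of w "u # us" v] by simp
  have PE: "P \<subseteq> E"
    using path P by simp
  have vu: "{v, u} \<in> P"
    unfolding P by simp
  have zP: "z \<notin> f" if "f \<in> P" for f
    using path_edges_subset[of f "v # u # us @ [w]"] that dist unfolding P by auto
  have at_v: "{e \<in> E. v \<in> e} = {{v, u}, {v, w}, {v, z}}"
  proof (rule card_seteq[symmetric])
    show "{{v, u}, {v, w}, {v, z}} \<subseteq> {e \<in> E. v \<in> e}"
      using vu PE vw vz by auto
    show "card {e \<in> E. v \<in> e} \<le> card {{v, u}, {v, w}, {v, z}}"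
    proof -
      have "deg E v = 3"
        using cubic[of v] vw by auto
      moreover have "card {{v, u}, {v, w}, {v, z}} = 3"
        using dist by (simp add: doubleton_eq_iff)
      ultimately show ?thesis
        by simp
    qed
  qed (use fin in simp)
  have vw_P: "{v, w} \<notin> P"
  proof
    assume "{v, w} \<in> P"
    then have "{v, w} \<in> path_edges (u # us @ [w])"
      unfolding P using dist by (auto simp: doubleton_eq_iff)
    then show False
      using path_edges_subset[of "{v, w}" "u # us @ [w]"] dist by auto
  qed
  have vz_P: "{v, z} \<notin> P"
    using zP by blast
  have vz_vw: "{v, z} \<noteq> {v, w}"
    using dist by (auto simp: doubleton_eq_iff)
  define T where "T = E - (P \<union> {{v, w}, {v, z}})"
  have TE: "T \<subseteq> E" and finT: "finite T"
    unfolding T_def using fin by auto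
  have edge_v: "f = {v, u} \<or> f = {v, w} \<or> f = {v, z}" if "f \<in> E" "v \<in> f" for f
  proof -
    have "f \<in> {e \<in> E. v \<in> e}"
      using that by simp
    then show ?thesis
      unfolding at_v by simp
  qed
  have vT: "v \<notin> f" if "f \<in> T" for f
    using edge_v[of f] that vu unfolding T_def by blast
  have "\<exists>c'. proper E c'" if c: "proper T c" for c
  proof -
    have "card {f \<in> T. z \<in> f \<and> f \<noteq> {v, z}} \<le> card {f \<in> E. z \<in> f \<and> f \<noteq> {v, z}}"
      using TE fin by (intro card_mono) auto
    also have "\<dots> = 2"
    proof -
      have "deg E z = 3"
        using cubic[of z] vz by auto
      then show ?thesis
        using card_other_edges[OF fin vz, of z] by simp
    qed
    finally have "card (neighbours T {v, z}) \<le> 2"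
      using card_neighbours_le[of T v z] vT by (simp add: card_eq_0_iff[THEN iffD2] cong: conj_cong)
    then have "2 \<le> card (available T c {v, z})"
      using card_available[OF finT, of "{v, z}" c] lists[OF vz] by linarith
    \<comment> \<open>The two colours that are reserved for the pendant edge.\<close>
    then obtain Q where Q: "Q \<subseteq> available T c {v, z}" "card Q = 2" "finite Q"
      by (meson obtain_subset_with_card_n)
    let ?l = "last (u # us)"
    have lw: "{?l, w} \<in> P" "?l \<noteq> v"
    proof -
      have "path_edges ((v # butlast (u # us)) @ ?l # [w]) = path_edges (v # u # us @ [w])"
        by (metis append_Cons append_Nil append_assoc append_butlast_last_id list.distinct(1))
      then show "{?l, w} \<in> P"
        unfolding P using path_edges_append[of "v # butlast (u # us)" ?l "[w]"] by auto
      show "?l \<noteq> v"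
        using dist by (auto split: if_splits)
    qed
    have "{f \<in> T. w \<in> f \<and> f \<noteq> {v, w}} \<subseteq> {f \<in> E. w \<in> f} - {{v, w}, {?l, w}}"
      using lw(1) TE unfolding T_def by auto
    then have "card {f \<in> T. w \<in> f \<and> f \<noteq> {v, w}} \<le> card ({f \<in> E. w \<in> f} - {{v, w}, {?l, w}})"
      using fin by (intro card_mono) auto
    also have "\<dots> = 3 - 2"
    proof -
      have "{{v, w}, {?l, w}} \<subseteq> {f \<in> E. w \<in> f}"
        using vw lw(1) PE by blast
      moreover have "{v, w} \<noteq> {?l, w}"
        using lw(2) by (metis doubleton_eq_iff)
      then have "card {{v, w}, {?l, w}} = 2"
        by (metis card_2_iff)
      moreover have "deg E w = 3"
        using cubic[of w] vw by auto
      ultimately show ?thesis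
        by (subst card_Diff_subset) simp_all
    qed
    finally have "card (neighbours T {v, w}) \<le> 1"
      using card_neighbours_le[of T v w] vT by (simp add: card_eq_0_iff[THEN iffD2] cong: conj_cong)
    then have A3: "3 \<le> card (available T c {v, w})"
      using card_available[OF finT, of "{v, w}" c] lists[OF vw] by linarith
    \<comment> \<open>Each reserved colour conflicts with at most one colour of \<open>vw\<close>.\<close>
    let ?bad = "\<Union>x\<in>Q. {y \<in> L {v, w}. R {v, w} {v, z} y x}"
    have "card ?bad \<le> (\<Sum>x\<in>Q. card {y \<in> L {v, w}. R {v, w} {v, z} y x})"
      by (rule card_UN_le[OF Q(3)])
    also have "\<dots> \<le> (\<Sum>x\<in>Q. 1)"
      by (intro sum_mono card_conflicts_le_1)
    finally have "card ?bad \<le> 2"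
      using Q(2) by simp
    moreover have "finite ?bad"
      using Q(3) lists[OF vw] by auto
    ultimately have "\<not> available T c {v, w} \<subseteq> ?bad"
      using A3 card_mono[of ?bad "available T c {v, w}"] by linarith
    then obtain y where y: "y \<in> available T c {v, w}" "y \<notin> ?bad"
      by blast
    have yQ: "\<not> R {v, z} {v, w} x y" if "x \<in> Q" for x
      using y that conflict_sym unfolding available_def by blast
    let ?T' = "insert {v, w} T"
    have c1: "proper ?T' (c({v, w} := y))"
      by (rule proper_insert[OF c y(1)]) (simp add: T_def)
    obtain b bs where bs: "rev (u # us) @ [v] = b # bs"
      by (cases "rev (u # us) @ [v]") auto
    have lastv: "last (b # bs) = v"
      using bs by (metis last_snoc)
    have Pb: "P = path_edges (w # b # bs)"
      unfolding P_def bs ..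
    have "\<exists>c'. proper (?T' \<union> path_edges (w # b # bs)) c' \<and> (\<forall>e\<in>?T'. c' e = (c({v, w} := y)) e)"
    proof (rule greedy_along_path[OF fin cubic lists, where g = "{v, z}"])
      have "distinct (w # rev (u # us) @ [v])"
        using dist by auto
      then show "distinct (w # b # bs)"
        unfolding bs .
      show "path_edges (w # b # bs) \<subseteq> E - ?T'"
        using PE vw_P unfolding Pb[symmetric] T_def by auto
      show "?T' \<subseteq> E"
        using TE vw by simp
      show "{v, z} \<in> E - ?T'"
        using vz vz_vw unfolding T_def by auto
      show "{v, z} \<notin> path_edges (w # b # bs)"
        using vz_P unfolding Pb .
      show "last (b # bs) \<in> {v, z}"
        using lastv by simp
      show "proper ?T' (c({v, w} := y))"
        by (rule c1)
    qed
    then obtain c' where c': "proper (?T' \<union> P) c'" "\<And>e. e \<in> ?T' \<Longrightarrow> c' e = (c({v, w} := y)) e"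
      unfolding Pb by blast
    have c'T: "c' f = c f" if "f \<in> T" for f
      using c'(2)[of f] that unfolding T_def by auto
    have c'vw: "c' {v, w} = y"
      using c'(2) by simp
    have "card {x \<in> L {v, z}. R {v, z} {v, u} x (c' {v, u})} \<le> 1"
      by (rule card_conflicts_le_1)
    moreover have "finite {x \<in> L {v, z}. R {v, z} {v, u} x (c' {v, u})}"
      using lists[OF vz] by simp
    ultimately have "\<not> Q \<subseteq> {x \<in> L {v, z}. R {v, z} {v, u} x (c' {v, u})}"
      using Q(2) card_mono[of "{x \<in> L {v, z}. R {v, z} {v, u} x (c' {v, u})}" Q] by linarith
    then obtain x where x: "x \<in> Q" "x \<in> L {v, z}" "\<not> R {v, z} {v, u} x (c' {v, u})"
      using Q(1) unfolding available_def by blast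
    have "x \<in> available (?T' \<union> P) c' {v, z}"
      unfolding available_def
    proof (intro CollectI conjI ballI x(2))
      fix f assume f: "f \<in> ?T' \<union> P"
      show "\<not> R {v, z} f x (c' f)"
      proof
        assume r: "R {v, z} f x (c' f)"
        consider "f = {v, w}" | "f \<in> T" | "f \<in> P"
          using f by blast
        then show False
        proof cases
          case 1
          then show ?thesis
            using yQ[OF x(1)] r c'vw by simp
        next
          case 2
          then show ?thesis
            using r Q(1) x(1) c'T unfolding available_def by auto
        next
          case 3
          then have "v \<in> f" "f \<in> E"
            using conflict_meet[OF r] zP[OF 3] PE by auto
          then have "f = {v, u}"
            using edge_v[of f] 3 vw_P vz_P by blast
          then show ?thesis
            using r x(3) by simp
        qed
      qed
    qed
    then have "proper (insert {v, z} (?T' \<union> P)) (c'({v, z} := x))"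
      by (rule proper_insert[OF c'(1)]) (use vz_P vz_vw in \<open>auto simp: T_def\<close>)
    moreover have "insert {v, z} (?T' \<union> P) = E"
      using PE vw vz unfolding T_def by auto
    ultimately show ?thesis
      by auto
  qed
  moreover have "E - (P \<union> {{v, w}, {v, z}}) = T"
    unfolding T_def ..
  ultimately show ?thesis
    unfolding reducible_def using PE vw vz by (intro exI[of _ "P \<union> {{v, w}, {v, z}}"]) auto
qed

end

section \<open>Group colourings of line graphs of planar graphs\<close>

lemma degree_le_max_degree:
  assumes "simple_graph G" "N \<subseteq> edges G" "v \<in> \<Union>N"
  shows "deg N v \<le> max_degree G"
proof -
  have fin: "finite (verts G)" "finite (edges G)"
    using assms(1) finite_subset[of "edges G" "Pow (verts G)"] unfolding simple_graph_def by auto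
  have "deg N v \<le> degree G v"
    unfolding degree_def using fin(2) assms(2) by (intro card_mono) auto
  also have "v \<in> verts G"
    using assms unfolding simple_graph_def by blast
  then have "degree G v \<le> max_degree G"
    unfolding max_degree_def using fin(1) by (intro Max_ge) auto
  finally show ?thesis .
qed

text \<open>Without a light edge all degrees are at least 3, so \<open>\<Delta> \<ge> 3\<close>, and \<open>\<Delta> = 3\<close> forces \<open>N\<close> to be
  cubic. If \<open>\<Delta> \<ge> 4\<close>, discharging over a cycle cover of \<open>N\<close> gives a contradiction. The cycles of
  the cover are cycles of \<open>G\<close>, and they are distinct, so two of them that share an edge are
  adjacent.\<close>

lemma light_edge_or_cubic:
  fixes s t :: int
  assumes "simple_graph G" "planar G"
    and cyc: "\<And>i j C C'. 3 \<le> int i \<Longrightarrow> int i \<le> s \<Longrightarrow> 3 \<le> int j \<Longrightarrow> int j \<le> t \<Longrightarrow>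
           is_cycle G i C \<Longrightarrow> is_cycle G j C' \<Longrightarrow> \<not> adjacent_cycles C C'"
    and cases: "(s = 3 \<and> t = 3 \<and> max_degree G \<ge> 8) \<or>
         (s = 3 \<and> t = 4 \<and> max_degree G \<ge> 6) \<or>
         (s = 4 \<and> t = 5 \<and> max_degree G \<ge> 5) \<or>
         (s = 4 \<and> t = 7)"
    and N: "N \<subseteq> edges G" "N \<noteq> {}"
  shows "(\<exists>u v. {u, v} \<in> N \<and> u \<noteq> v \<and> deg N u + deg N v \<le> max_degree G + 2) \<or>
    max_degree G = 3 \<and> (\<forall>v\<in>\<Union>N. deg N v = 3)"
proof (rule ccontr)
  assume contr: "\<not> ?thesis"
  let ?D = "max_degree G"
  have card2: "card e = 2" if "e \<in> N" for e
    using assms(1) N(1) that unfolding simple_graph_def by blast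
  have sum: "?D + 3 \<le> deg N u + deg N v" if "{u, v} \<in> N" for u v
  proof -
    have "u \<noteq> v"
      using card2[OF that] by auto
    then have "\<not> deg N u + deg N v \<le> ?D + 2"
      using contr that by blast
    then show ?thesis
      by simp
  qed
  have le: "deg N v \<le> ?D" if "v \<in> \<Union>N" for v
    by (rule degree_le_max_degree[OF assms(1) N(1) that])
  have degrees: "3 \<le> ?D \<and> 3 \<le> deg N v" if v: "v \<in> \<Union>N" for v
  proof -
    obtain e where e: "e \<in> N" "v \<in> e"
      using v by blast
    then obtain w where w: "e = {v, w}"
      using card2[of e] by (auto simp: card_2_iff)
    then have "deg N w \<le> ?D" "?D + 3 \<le> deg N v + deg N w"
      using le[of w] sum[of v w] e by auto
    then show ?thesis
      using le[OF v] by linarith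
  qed
  obtain e where "e \<in> N"
    using N(2) by blast
  moreover from this obtain v where "v \<in> e"
    using card2[of e] by fastforce
  ultimately have "v \<in> \<Union>N"
    by blast
  then have "3 \<le> ?D"
    using degrees by blast
  moreover have "?D \<noteq> 3"
  proof
    assume "?D = 3"
    then have "deg N v = 3" if "v \<in> \<Union>N" for v
      using degrees[OF that] le[OF that] by simp
    then show False
      using contr \<open>?D = 3\<close> by blast
  qed
  ultimately have D4: "4 \<le> ?D"
    by simp
  obtain V E where G: "G = (V, E)"
    by (rule prod.exhaust)
  obtain p \<gamma> where "plane_drawing G p \<gamma>"
    using assms(2) unfolding planar_def by blast
  then interpret plane_graph V E p \<gamma>
    using assms(1) unfolding G by unfold_locales
  have NE: "N \<subseteq> E"
    using N(1) unfolding G by simp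
  obtain F where F: "\<forall>C\<in>F. graph_cycle C \<and> C \<subseteq> N" "\<forall>e\<in>N. card {C \<in> F. e \<in> C} \<le> 2"
    "card N + 1 \<le> card (\<Union>N) + card F"
    using ex_cycle_cover[OF NE N(2)] by (elim exE conjE)
  interpret cycle_cover N F
  proof
    show "finite N"
      by (rule finite_subset[OF NE finite_E])
  qed (use F card2 in simp_all)
  have cycle: "is_cycle G (card C) C" if "C \<in> F" for C
  proof -
    have "\<Union>(edges G) \<subseteq> verts G"
      using edge_subset unfolding G by auto
    moreover have "graph_cycle C" "C \<subseteq> edges G"
      using F(1) that NE unfolding G by auto
    ultimately show ?thesis
      by (simp add: is_cycle_iff)
  qed
  have short: "\<not> (int (card C) \<le> s \<and> int (card C') \<le> t)"
    if "C \<in> F" "C' \<in> F" "C \<noteq> C'" "C \<inter> C' \<noteq> {}" for C C'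
    using cyc[OF _ _ _ _ cycle[OF that(1)] cycle[OF that(2)]] cycle_length[OF that(1)] cycle_length[OF that(2)] that(3,4)
    unfolding adjacent_cycles_def by auto
  from cases show False
  proof (elim disjE conjE)
    assume "s = 3" "t = 3" "8 \<le> ?D"
    then show False
      using no_cover_without_adjacent_triangles[OF le sum] short by force
  next
    assume "s = 3" "t = 4" "6 \<le> ?D"
    then show False
      using no_cover_without_triangle_next_to_4_cycle[OF le sum] short by force
  next
    assume "s = 4" "t = 5" "5 \<le> ?D"
    then show False
      using no_cover_without_short_next_to_5_cycle[OF le sum] short by force
  next
    assume "s = 4" "t = 7"
    then show False
      using no_cover_without_short_next_to_7_cycle[OF le sum D4] short by force
  qed
qed

lemma line_graph_edge:
  assumes "orientation (line_graph G) D" "(e, f) \<in> D"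
  shows "e \<in> edges G" "f \<in> edges G" "e \<noteq> f" "e \<inter> f \<noteq> {}" "(f, e) \<notin> D"
proof -
  have bij: "bij_betw (\<lambda>(u, v). {u, v}) D (edges (line_graph G))"
    using assms(1) unfolding orientation_def .
  then have "{e, f} \<in> edges (line_graph G)"
    using assms(2) by (auto dest!: bij_betw_imp_surj_on)
  then show *: "e \<in> edges G" "f \<in> edges G" "e \<noteq> f" "e \<inter> f \<noteq> {}"
    unfolding line_graph_def by (auto simp: doubleton_eq_iff)
  show "(f, e) \<notin> D"
    using inj_onD[OF bij_betw_imp_inj_on[OF bij], of "(e, f)" "(f, e)"] assms(2) *(3)
    by (auto simp: insert_commute)
qed

text \<open>Symmetric in the two edges: the constraint of \<open>D\<close> is read from both ends.\<close>

definition group_conflict ::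
  "'g monoid \<Rightarrow> ('v set \<times> 'v set) set \<Rightarrow> ('v set set \<Rightarrow> 'g) \<Rightarrow> 'v set \<Rightarrow> 'v set \<Rightarrow> 'g \<Rightarrow> 'g \<Rightarrow> bool" where
  "group_conflict A D f a b x y \<longleftrightarrow> x \<in> carrier A \<and> y \<in> carrier A \<and>
    ((a, b) \<in> D \<and> x \<otimes>\<^bsub>A\<^esub> inv\<^bsub>A\<^esub> y = f {a, b} \<or> (b, a) \<in> D \<and> y \<otimes>\<^bsub>A\<^esub> inv\<^bsub>A\<^esub> x = f {a, b})"

text \<open>Exactly one of \<open>(a, b)\<close> and \<open>(b, a)\<close> is in \<open>D\<close>, so there is one equation for each pair of
  edges, and either side of it determines the other by cancellation.\<close>

lemma correspondence_group_conflict: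
  assumes "comm_group A" "orientation (line_graph G) D"
  shows "correspondence (group_conflict A D f) L"
proof
  interpret comm_group A
    by (rule assms(1))
  fix a b x y x'
  assume r: "group_conflict A D f a b x y"
  show "group_conflict A D f b a y x"
    using r unfolding group_conflict_def by (auto simp: insert_commute)
  show "a \<noteq> b \<and> a \<inter> b \<noteq> {}"
    using r line_graph_edge[OF assms(2)] unfolding group_conflict_def by (metis Int_commute)
  assume r': "group_conflict A D f a b x' y"
  have carr: "x \<in> carrier A" "x' \<in> carrier A" "y \<in> carrier A"
    using r r' unfolding group_conflict_def by auto
  consider "(a, b) \<in> D" "(b, a) \<notin> D" | "(b, a) \<in> D" "(a, b) \<notin> D"
    using r line_graph_edge(5)[OF assms(2)] unfolding group_conflict_def by blast
  then show "x = x'"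
  proof cases
    case 1
    then have "x \<otimes>\<^bsub>A\<^esub> inv\<^bsub>A\<^esub> y = x' \<otimes>\<^bsub>A\<^esub> inv\<^bsub>A\<^esub> y"
      using r r' unfolding group_conflict_def by simp
    then show ?thesis
      using carr by simp
  next
    case 2
    then have "y \<otimes>\<^bsub>A\<^esub> inv\<^bsub>A\<^esub> x = y \<otimes>\<^bsub>A\<^esub> inv\<^bsub>A\<^esub> x'"
      using r r' unfolding group_conflict_def by simp
    then have "inv\<^bsub>A\<^esub> x = inv\<^bsub>A\<^esub> x'"
      using carr by simp
    then show ?thesis
      using carr by (metis inv_inv)
  qed
qed

theorem theorem2p4:
  fixes G :: "'v graph" and s t :: int
  assumes "simple_graph G"
    and "planar G"
    and "\<And>i j C C'. 3 \<le> int i \<Longrightarrow> int i \<le> s \<Longrightarrow> 3 \<le> int j \<Longrightarrow> int j \<le> t \<Longrightarrow>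
           is_cycle G i C \<Longrightarrow> is_cycle G j C' \<Longrightarrow> \<not> adjacent_cycles C C'"
    and "(s = 3 \<and> t = 3 \<and> max_degree G \<ge> 8) \<or>
         (s = 3 \<and> t = 4 \<and> max_degree G \<ge> 6) \<or>
         (s = 4 \<and> t = 5 \<and> max_degree G \<ge> 5) \<or>
         (s = 4 \<and> t = 7)"
  shows "group_edge_choosable TYPE('g) G (max_degree G + 1)"
  unfolding group_edge_choosable_def group_choosable_def
proof (intro allI impI)
  fix A :: "'g monoid" and D L f
  assume A: "comm_group A" and D: "orientation (line_graph G) D"
    and L: "\<forall>e\<in>verts (line_graph G). L e \<subseteq> carrier A \<and> finite (L e) \<and> card (L e) = max_degree G + 1"
  interpret correspondence "group_conflict A D f" L
    by (rule correspondence_group_conflict[OF A D])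
  have vl: "verts (line_graph G) = edges G"
    unfolding line_graph_def by simp
  have lists: "L e \<subseteq> carrier A \<and> finite (L e) \<and> card (L e) = max_degree G + 1" if "e \<in> edges G" for e
    using L that unfolding vl by blast
  have fin: "finite (edges G)" and card2: "\<And>e. e \<in> edges G \<Longrightarrow> card e = 2"
    using assms(1) finite_subset[of "edges G" "Pow (verts G)"] unfolding simple_graph_def by auto
  have "reducible N" if N: "N \<subseteq> edges G" "N \<noteq> {}" for N
  proof -
    have finN: "finite N"
      using finite_subset[OF N(1) fin] .
    have "(\<exists>u v. {u, v} \<in> N \<and> u \<noteq> v \<and> deg N u + deg N v \<le> max_degree G + 2) \<or>
      max_degree G = 3 \<and> (\<forall>v\<in>\<Union>N. deg N v = 3)"
      by (rule light_edge_or_cubic[where s = s and t = t]) (fact assms N)+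
    then show ?thesis
    proof (elim disjE exE conjE)
      fix u v assume uv: "{u, v} \<in> N" "u \<noteq> v" "deg N u + deg N v \<le> max_degree G + 2"
      then have "finite (L {u, v})" "card (L {u, v}) = max_degree G + 1"
        using lists[of "{u, v}"] N(1) by auto
      then show ?thesis
        using light_edge_reducible[OF finN uv(1,2)] uv(3) by simp
    next
      assume "max_degree G = 3" "\<forall>v\<in>\<Union>N. deg N v = 3"
      moreover have "card e = 2" "finite (L e) \<and> card (L e) = max_degree G + 1" if "e \<in> N" for e
        using lists[of e] card2[of e] N(1) that by auto
      ultimately show ?thesis
        by (intro cubic_reducible[OF finN _ N(2)]) auto
    qed
  qed
  then obtain c where c: "proper (edges G) c"
    using colourable_if_reducible[OF fin] by blast
  have cL: "c e \<in> L e" if "e \<in> edges G" for e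
    using c that unfolding proper_def by blast
  have "group_coloring A (line_graph G) D f c"
    unfolding group_coloring_def
  proof (intro conjI ballI)
    show "c e \<in> carrier A" if "e \<in> verts (line_graph G)" for e
      using cL lists that unfolding vl by blast
    fix q assume "q \<in> D"
    then obtain a b where q: "q = (a, b)" "(a, b) \<in> D"
      by (cases q) simp
    then have ab: "a \<in> edges G" "b \<in> edges G"
      using line_graph_edge[OF D q(2)] by auto
    then have "\<not> group_conflict A D f a b (c a) (c b)"
      using c unfolding proper_def by blast
    then show "case q of (a, b) \<Rightarrow> c a \<otimes>\<^bsub>A\<^esub> inv\<^bsub>A\<^esub> c b \<noteq> f {a, b}"
      using q ab cL lists unfolding group_conflict_def by blast
  qed
  then show "\<exists>c. group_coloring A (line_graph G) D f c \<and> (\<forall>e\<in>verts (line_graph G). c e \<in> L e)"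
    using cL unfolding vl by blast
qed

end
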